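(* Let $X_1,X_2,\dots$ be independent and identically distributed real random variables and put $S_n=X_1+\dots+X_n$. Then $$\sum_{n=2}^\infty n^{-1}P\bigl(|S_n|\ge\varepsilon(n\log n)^{1/2}\bigr)<\infty\quad\text{for all }\varepsilon>0$$ if and only if all of the following three conditions hold: (a) $E[X_1]=0$; (b) $E[X_1^2/\log^+|X_1|]<\infty$; (c) $\sum_{n=2}^\infty n^{-1-\varepsilon^2/T_{\varepsilon,n}}<\infty$ for all $\varepsilon>0$, where $T_{\varepsilon,n}=E[X_1^2\cdot1_{\{|X_1|<\varepsilon(n\log n)^{1/2}\}}]$.
   Context: Here $\log^+x$ denotes $\log(2+x)$ (natural logarithm). In (c), the $n$-th summand is interpreted as $0$ when $T_{\varepsilon,n}=0$ (i.e. $n^{-1-t/0}=0$ for $t>0$, $n\ge 2$). *)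

theory Defs
  imports "HOL-Probability.Probability"
begin

definition log_plus :: "real \<Rightarrow> real" where
  "log_plus x = ln (2 + x)"

definition partial_sum :: "(nat \<Rightarrow> 'a \<Rightarrow> real) \<Rightarrow> nat \<Rightarrow> 'a \<Rightarrow> real" where
  "partial_sum X n \<omega> = (\<Sum>i = 1..n. X i \<omega>)"

definition trunc_second_moment :: "'a measure \<Rightarrow> ('a \<Rightarrow> real) \<Rightarrow> real \<Rightarrow> nat \<Rightarrow> real" where
  "trunc_second_moment M Y \<epsilon> n =
     (LINT \<omega>|M. (Y \<omega>)\<^sup>2 * indicator {\<omega>. \<bar>Y \<omega>\<bar> < \<epsilon> * sqrt (real n * ln (real n))} \<omega>)"

(* Division by zero would otherwise turn the summand into 1 / n when T = 0;
   the intended value is the limit 0 as T decreases to 0. *)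
definition tail_term :: "real \<Rightarrow> real \<Rightarrow> nat \<Rightarrow> real" where
  "tail_term \<epsilon> T n = (if T = 0 then 0 else real n powr (- 1 - \<epsilon>\<^sup>2 / T))"

end

theory Submission
  imports Defs "HOL-Real_Asymp.Real_Asymp"
begin

text \<open>
  Write \<open>b\<^sub>n = sqrt (n log n)\<close>, called \<open>thr n\<close> below.

  Sufficiency: split off the summands exceeding \<open>t / 8\<close> with \<open>t = \<epsilon> b\<^sub>n\<close>, and apply the exponential Markov inequality
  to the truncated sum.  The parameter \<open>h\<close> starts at its Gaussian value \<open>t / (8 n T)\<close> and is
  halved until the contribution of the summands larger than \<open>1 / h\<close> to the exponent is harmless.  If no halving was
  needed, the bound is the Gaussian one of condition (c).  Otherwise the last rejected value of \<open>h\<close> bounds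
  \<open>exp (- h t / 2)\<close> linearly by \<open>n E exp (- t / (8 \<bar>X\<bar>))\<close>; divided by \<open>n\<close> this is summable
  because \<open>\<Sum>\<^sub>n exp (- c b\<^sub>n / \<bar>x\<bar>)\<close> is at most of order \<open>x\<^sup>2 / log x\<close>.

  Necessity: pass to the differences of consecutive pairs, which are symmetric.  Levy's inequality for the largest
  summand gives (b), and then the upper bound shows that a nonzero mean is impossible.  For (c), flipping the signs
  of the large summands shows that truncation at any level costs only a factor 2, and truncating at
  \<open>n powr (1/4)\<close> makes the Paley--Zygmund inequality for \<open>exp (h S)\<close> give a lower bound
  \<open>n powr (- C \<epsilon>\<^sup>2 / T)\<close>.  The low truncation level is harmless: replacing \<open>n\<close> by \<open>n\<^sup>3\<close>
  changes \<open>log n\<close> only by a constant factor, and (c) is required for every \<open>\<epsilon>\<close>.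
\<close>

section \<open>Exponential upper bound for truncated sums\<close>

text \<open>The obstacle is that \<open>T\<close> may lie anywhere between a positive constant and
  order \<open>log n\<close>. If it is small against \<open>log n\<close>, the Gaussian parameter
  \<open>t / (8 n T)\<close> times the truncation level \<open>t / 8\<close> is of order
  \<open>log n / T\<close>, hence large: truncated values need not be small in the exponent, and a
  quadratic estimate of the moment generating function fails. A lower truncation level would repair
  this, but under (b) alone the discarded summands would then be too frequent. So the upper bound
  keeps the high level and charges the dangerous values to the weight exp (- t / |x|), while the
  lower bound, where discarding costs only a factor 2, truncates low.

  The weight plays two roles: it dominates the excess of the exponential moment, and up to the
  factor 3 it dominates the indicator of |x| >= t. Condition (b) amounts to the summability of P(|X|
  >= b_n), and passing from indicators to weights preserves that summability.\<close>

definition trunc :: "real \<Rightarrow> real \<Rightarrow> real" where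
  "trunc y x = (if \<bar>x\<bar> < y then x else 0)"

text \<open>The value at 0 is the limit for \<open>t > 0\<close>; without the case split, division
  by zero would give exp 0 = 1.\<close>

definition jump_weight :: "real \<Rightarrow> real \<Rightarrow> real" where
  "jump_weight t x = (if x = 0 then 0 else exp (- t / \<bar>x\<bar>))"

lemma trunc_measurable [measurable]: "trunc y \<in> borel_measurable borel"
  unfolding trunc_def by measurable

lemma jump_weight_measurable [measurable]: "jump_weight t \<in> borel_measurable borel"
  unfolding jump_weight_def by measurable

lemma abs_trunc_le: "0 \<le> y \<Longrightarrow> \<bar>trunc y x\<bar> \<le> y"
  by (auto simp: trunc_def)

lemma trunc_minus: "trunc y (- x) = - trunc y x"
  by (auto simp: trunc_def)

lemma jump_weight_minus: "jump_weight t (- x) = jump_weight t x"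
  by (auto simp: jump_weight_def)

lemma jump_weight_nonneg: "0 \<le> jump_weight t x"
  by (auto simp: jump_weight_def)

lemma jump_weight_le_1: "0 \<le> t \<Longrightarrow> jump_weight t x \<le> 1"
  by (auto simp: jump_weight_def)

text \<open>The linear term has coefficient exactly 1, so that after integration the mean appears
  undistorted and can be cancelled by centring. For |x| > 1 the term exp |x| pays for
  everything.\<close>

lemma exp_le_quadratic_plus_jump:
  fixes x :: real
  shows "exp x \<le> 1 + x + x\<^sup>2 + (if \<bar>x\<bar> > 1 then exp \<bar>x\<bar> else 0)"
proof (cases "\<bar>x\<bar> > 1")
  case True
  show ?thesis
  proof (cases "x > 0")
    case True
    with \<open>\<bar>x\<bar> > 1\<close> show ?thesis by (simp add: add_nonneg_nonneg)
  next
    case False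
    have "1 - x \<le> exp (- x)" using exp_ge_add_one_self[of "-x"] by simp
    moreover have "exp x \<le> 1" using False by simp
    ultimately have "exp x \<le> 1 + x + exp (- x)" using False by linarith
    moreover have "\<bar>x\<bar> = - x" using False by simp
    ultimately show ?thesis unfolding if_P[OF True] using zero_le_power2[of x] by linarith
  qed
next
  case False
  show ?thesis
  proof (cases "x \<ge> 0")
    case True
    then show ?thesis using exp_bound[of x] False by simp
  next
    case neg: False
    \<comment> \<open>A lower Taylor bound for exp (-x) suffices: its product with
      \<open>1 + x + x^2\<close> exceeds 1 by a sum of terms that are all nonnegative for negative
      \<open>x\<close>.\<close>
    have "1 - x + x\<^sup>2/2 \<le> exp (-x)" using exp_lower_Taylor_quadratic[of "-x"] neg by simp
    moreover have "(1 - x + x\<^sup>2/2) * (1 + x + x\<^sup>2) - 1 = x\<^sup>2/2 - x^3/2 + x^4/2"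
      by (simp add: field_simps power2_eq_square power3_eq_cube power4_eq_xxxx)
    moreover have "x^3 \<le> 0" using neg by (simp add: power_le_zero_eq)
    moreover have "x^4 \<ge> 0" by simp
    ultimately have "1 \<le> (1 - x + x\<^sup>2/2) * (1 + x + x\<^sup>2)" using zero_le_power2[of x] by linarith
    also have "\<dots> \<le> exp (-x) * (1 + x + x\<^sup>2)"
      using \<open>1 - x + x\<^sup>2/2 \<le> exp (-x)\<close> False by (intro mult_right_mono) auto
    finally have "exp x * 1 \<le> exp x * (exp (-x) * (1 + x + x\<^sup>2))" by (intro mult_left_mono) auto
    also have "\<dots> = 1 + x + x\<^sup>2" by (simp add: exp_minus)
    finally show ?thesis using False by simp
  qed
qed

context prob_space
begin

lemma bounded_integrable:
  fixes f :: "'a \<Rightarrow> real"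
  assumes "random_variable borel f" "\<And>\<omega>. \<omega> \<in> space M \<Longrightarrow> \<bar>f \<omega>\<bar> \<le> B"
  shows "integrable M f"
  by (rule integrable_const_bound[of _ B]) (use assms in auto)

lemma integrable_trunc [intro]:
  assumes "random_variable borel Y"
  shows "integrable M (\<lambda>\<omega>. trunc y (Y \<omega>))"
  by (rule bounded_integrable[of _ "\<bar>y\<bar>"]) (use assms in \<open>auto simp: trunc_def\<close>)

lemma integrable_trunc_sq [intro]:
  assumes [measurable]: "random_variable borel Y"
  shows "integrable M (\<lambda>\<omega>. (trunc y (Y \<omega>))\<^sup>2)"
proof (rule bounded_integrable[of _ "\<bar>y\<bar>\<^sup>2"])
  fix \<omega>
  have "\<bar>trunc y (Y \<omega>)\<bar>\<^sup>2 \<le> \<bar>y\<bar>\<^sup>2" by (intro power_mono) (auto simp: trunc_def)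
  then show "\<bar>(trunc y (Y \<omega>))\<^sup>2\<bar> \<le> \<bar>y\<bar>\<^sup>2" by simp
qed measurable

lemma integrable_jump_weight [intro]:
  assumes "random_variable borel Y" "0 \<le> t"
  shows "integrable M (\<lambda>\<omega>. jump_weight t (Y \<omega>))"
  by (rule bounded_integrable[of _ 1]) (use assms in \<open>auto simp: jump_weight_le_1 jump_weight_nonneg\<close>)

lemma expectation_if_eq_prob:
  assumes "Measurable.pred M Q"
  shows "expectation (\<lambda>\<omega>. if Q \<omega> then 1 else 0 :: real) = \<P>(\<omega> in M. Q \<omega>)"
proof -
  have "expectation (\<lambda>\<omega>. if Q \<omega> then 1 else 0 :: real) = expectation (indicator {\<omega> \<in> space M. Q \<omega>})"
    by (intro Bochner_Integration.integral_cong) (auto simp: indicator_def)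
  then show ?thesis using assms by simp
qed

lemma expectation_ident:
  fixes g :: "real \<Rightarrow> real"
  assumes "random_variable borel U" "random_variable borel V" "distr M borel U = distr M borel V"
    and "g \<in> borel_measurable borel"
  shows "expectation (\<lambda>\<omega>. g (U \<omega>)) = expectation (\<lambda>\<omega>. g (V \<omega>))"
  using integral_distr[OF assms(1,4)] integral_distr[OF assms(2,4)] assms(3) by simp

lemma prob_ident:
  fixes U V :: "'a \<Rightarrow> real"
  assumes "random_variable borel U" "random_variable borel V" "distr M borel U = distr M borel V"
    and "A \<in> sets borel"
  shows "\<P>(\<omega> in M. U \<omega> \<in> A) = \<P>(\<omega> in M. V \<omega> \<in> A)"
proof -
  have *: "measure (distr M borel W) A = \<P>(\<omega> in M. W \<omega> \<in> A)" if "random_variable borel W" for W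
    using measure_distr[OF that assms(4)] by (simp add: vimage_def Int_def conj_commute)
  show ?thesis using *[OF assms(1)] *[OF assms(2)] assms(3) by simp
qed

lemma expectation_exp_sum_iid:
  fixes Z :: "'i \<Rightarrow> 'a \<Rightarrow> real" and g :: "real \<Rightarrow> real"
  assumes "finite I" and "indep_vars (\<lambda>_. borel) Z I"
    and Z0: "random_variable borel Z0"
    and ident: "\<And>i. i \<in> I \<Longrightarrow> distr M borel (Z i) = distr M borel Z0"
    and g [measurable]: "g \<in> borel_measurable borel" and bdd: "\<And>x. \<bar>g x\<bar> \<le> B"
  shows "expectation (\<lambda>\<omega>. exp (h * (\<Sum>i\<in>I. g (Z i \<omega>)))) = expectation (\<lambda>\<omega>. exp (h * g (Z0 \<omega>))) ^ card I"
    and "integrable M (\<lambda>\<omega>. exp (h * (\<Sum>i\<in>I. g (Z i \<omega>))))"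
proof -
  have rv: "random_variable borel (Z i)" if "i \<in> I" for i
    using assms(2) that by (auto simp: indep_vars_def)
  have ind: "indep_vars (\<lambda>_. borel) (\<lambda>i \<omega>. exp (h * g (Z i \<omega>))) I"
    by (rule indep_vars_compose2[OF assms(2)]) measurable
  have int: "integrable M (\<lambda>\<omega>. exp (h * g (Z i \<omega>)))" if "i \<in> I" for i
  proof (rule bounded_integrable[of _ "exp (\<bar>h\<bar> * B)"])
    show "random_variable borel (\<lambda>\<omega>. exp (h * g (Z i \<omega>)))" using rv[OF that] by measurable
    fix \<omega>
    have "h * g (Z i \<omega>) \<le> \<bar>h\<bar> * B"
      using abs_mult[of h "g (Z i \<omega>)"] mult_left_mono[OF bdd, of "\<bar>h\<bar>" "Z i \<omega>"] by linarith
    then show "\<bar>exp (h * g (Z i \<omega>))\<bar> \<le> exp (\<bar>h\<bar> * B)" by simp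
  qed
  have eq: "(\<lambda>\<omega>. exp (h * (\<Sum>i\<in>I. g (Z i \<omega>)))) = (\<lambda>\<omega>. \<Prod>i\<in>I. exp (h * g (Z i \<omega>)))"
    using \<open>finite I\<close> by (simp add: sum_distrib_left exp_sum)
  show "integrable M (\<lambda>\<omega>. exp (h * (\<Sum>i\<in>I. g (Z i \<omega>))))"
    unfolding eq by (rule indep_vars_integrable[OF \<open>finite I\<close> ind int])
  have "expectation (\<lambda>\<omega>. exp (h * (\<Sum>i\<in>I. g (Z i \<omega>)))) = (\<Prod>i\<in>I. expectation (\<lambda>\<omega>. exp (h * g (Z i \<omega>))))"
    unfolding eq by (rule indep_vars_lebesgue_integral[OF \<open>finite I\<close> ind int])
  also have "\<dots> = (\<Prod>i\<in>I. expectation (\<lambda>\<omega>. exp (h * g (Z0 \<omega>))))"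
    by (intro prod.cong refl expectation_ident[OF rv Z0 ident, of _ "\<lambda>x. exp (h * g x)"]) auto
  finally show "expectation (\<lambda>\<omega>. exp (h * (\<Sum>i\<in>I. g (Z i \<omega>)))) = expectation (\<lambda>\<omega>. exp (h * g (Z0 \<omega>))) ^ card I"
    by simp
qed

text \<open>\<open>T\<close> is any positive upper bound of the truncated second moment rather than
  the moment itself, so that a vanishing moment can later be reached as a limit.\<close>

lemma trunc_sum_upper_pos:
  fixes Z :: "'i \<Rightarrow> 'a \<Rightarrow> real" and t T :: real
  assumes "finite I" and indep: "indep_vars (\<lambda>_. borel) Z I"
    and Z0 [measurable]: "random_variable borel Z0"
    and ident: "\<And>i. i \<in> I \<Longrightarrow> distr M borel (Z i) = distr M borel Z0"
    and t: "0 < t" and T: "0 < T" and T_ge: "expectation (\<lambda>\<omega>. (trunc (t/8) (Z0 \<omega>))\<^sup>2) \<le> T"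
  shows "\<P>(\<omega> in M. (\<Sum>i\<in>I. trunc (t/8) (Z i \<omega>)) \<ge> real (card I) * expectation (\<lambda>\<omega>. trunc (t/8) (Z0 \<omega>)) + t)
    \<le> exp (- t\<^sup>2 / (16 * real (card I) * T)) + real (card I) * expectation (\<lambda>\<omega>. jump_weight (t/8) (Z0 \<omega>))"
proof (cases "card I = 0")
  case True
  then show ?thesis by simp
next
  case False
  define n where "n = real (card I)"
  have n: "n > 0" using False by (simp add: n_def)
  define m where "m = expectation (\<lambda>\<omega>. trunc (t/8) (Z0 \<omega>))"
  define T0 where "T0 = expectation (\<lambda>\<omega>. (trunc (t/8) (Z0 \<omega>))\<^sup>2)"
  \<comment> \<open>The part of the exponential moment at parameter \<open>h\<close> that the
    quadratic does not absorb; \<open>J h\<close> collects it over all summands.\<close>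
  define j where "j h x = (if 1 < h * \<bar>x\<bar> \<and> \<bar>x\<bar> < t/8 then exp (h * \<bar>x\<bar>) else 0)" for h x :: real
  have [measurable]: "j h \<in> borel_measurable borel" for h unfolding j_def by measurable
  define J where "J h = n * expectation (\<lambda>\<omega>. j h (Z0 \<omega>))" for h
  define P where "P = \<P>(\<omega> in M. (\<Sum>i\<in>I. trunc (t/8) (Z i \<omega>)) \<ge> n * m + t)"
  note intT = integrable_trunc[OF Z0, of "t/8"] and intT2 = integrable_trunc_sq[OF Z0, of "t/8"]
  have intj: "integrable M (\<lambda>\<omega>. j h (Z0 \<omega>))" if "h > 0" for h
  proof (rule bounded_integrable[of _ "exp (h * (t/8))"])
    fix \<omega> show "\<bar>j h (Z0 \<omega>)\<bar> \<le> exp (h * (t/8))" using that by (auto simp: j_def mult_left_mono)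
  qed measurable
  have intw: "integrable M (\<lambda>\<omega>. jump_weight (t/8) (Z0 \<omega>))"
    using t by (intro integrable_jump_weight Z0) simp
  have w_nonneg: "0 \<le> n * expectation (\<lambda>\<omega>. jump_weight (t/8) (Z0 \<omega>))"
    using n by (intro mult_nonneg_nonneg integral_nonneg_AE) (auto simp: jump_weight_nonneg)
  have chernoff: "P \<le> exp (h\<^sup>2 * n * T0 + J h - h * t)" if h: "h > 0" for h
  proof -
    have pt: "exp (h * trunc (t/8) x) \<le> 1 + h * trunc (t/8) x + h\<^sup>2 * (trunc (t/8) x)\<^sup>2 + j h x" for x
      using exp_le_quadratic_plus_jump[of "h * trunc (t/8) x"] h t
      by (auto simp: trunc_def j_def abs_mult power_mult_distrib split: if_splits)
    have mgf: "expectation (\<lambda>\<omega>. exp (h * trunc (t/8) (Z0 \<omega>))) \<le> 1 + h * m + h\<^sup>2 * T0 + J h / n"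
    proof -
      have "expectation (\<lambda>\<omega>. exp (h * trunc (t/8) (Z0 \<omega>))) \<le>
            expectation (\<lambda>\<omega>. 1 + h * trunc (t/8) (Z0 \<omega>) + h\<^sup>2 * (trunc (t/8) (Z0 \<omega>))\<^sup>2 + j h (Z0 \<omega>))"
      proof (rule integral_mono)
        show "integrable M (\<lambda>\<omega>. exp (h * trunc (t/8) (Z0 \<omega>)))"
          by (rule bounded_integrable[of _ "exp (h * (t/8))"]) (use h t in \<open>auto simp: trunc_def\<close>)
      qed (use intT intT2 intj[OF h] pt in auto)
      also have "\<dots> = 1 + h * m + h\<^sup>2 * T0 + J h / n"
        using intT intT2 intj[OF h] n by (simp add: m_def T0_def J_def prob_space)
      finally show ?thesis .
    qed
    also have "\<dots> \<le> exp (h * m + h\<^sup>2 * T0 + J h / n)"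
      using exp_ge_add_one_self[of "h * m + h\<^sup>2 * T0 + J h / n"] by linarith
    finally have mgf: "expectation (\<lambda>\<omega>. exp (h * trunc (t/8) (Z0 \<omega>))) \<le> exp (h * m + h\<^sup>2 * T0 + J h / n)" .
    have g: "\<bar>trunc (t/8) x\<bar> \<le> t/8" for x using t abs_trunc_le[of "t/8"] by auto
    have E: "expectation (\<lambda>\<omega>. exp (h * (\<Sum>i\<in>I. trunc (t/8) (Z i \<omega>)))) =
        expectation (\<lambda>\<omega>. exp (h * trunc (t/8) (Z0 \<omega>))) ^ card I"
      "integrable M (\<lambda>\<omega>. exp (h * (\<Sum>i\<in>I. trunc (t/8) (Z i \<omega>))))"
      using expectation_exp_sum_iid[OF \<open>finite I\<close> indep Z0 ident trunc_measurable g] by blast+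
    have "P = \<P>(\<omega> in M. exp (h * (\<Sum>i\<in>I. trunc (t/8) (Z i \<omega>))) \<ge> exp (h * (n * m + t)))"
      using h by (simp add: P_def)
    also have "\<dots> \<le> expectation (\<lambda>\<omega>. exp (h * (\<Sum>i\<in>I. trunc (t/8) (Z i \<omega>)))) / exp (h * (n * m + t))"
      by (rule integral_Markov_inequality_measure[where A = "{}"]) (use E(2) in auto)
    also have "\<dots> \<le> exp (h * m + h\<^sup>2 * T0 + J h / n) ^ card I / exp (h * (n * m + t))"
      unfolding E(1) using mgf by (intro divide_right_mono power_mono) (auto intro!: integral_nonneg_AE)
    also have "\<dots> = exp (n * (h * m + h\<^sup>2 * T0 + J h / n) - h * (n * m + t))"
      by (simp add: exp_diff n_def exp_of_nat_mult)
    also have "n * (h * m + h\<^sup>2 * T0 + J h / n) - h * (n * m + t) = h\<^sup>2 * n * T0 + J h - h * t"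
      using n by (simp add: field_simps)
    finally show ?thesis .
  qed
  \<comment> \<open>A quarter of the minimiser \<open>t / (2 n T)\<close> of
    \<open>h^2 n T - h t\<close>. For every \<open>h\<close> up to \<open>h1\<close> the quadratic
    term uses only an eighth of \<open>h t\<close>, which leaves room for
    \<open>J h\<close>.\<close>
  define h1 where "h1 = t / (8 * n * T)"
  have h1: "h1 > 0" using t n T by (simp add: h1_def)
  have quad: "h\<^sup>2 * n * T0 \<le> h * t / 8" if "0 < h" "h \<le> h1" for h
  proof -
    have "h\<^sup>2 * n * T0 \<le> h\<^sup>2 * n * T" using n T_ge by (intro mult_left_mono) (auto simp: T0_def)
    also have "\<dots> = h * (h * (n * T))" by (simp add: power2_eq_square)
    also have "\<dots> \<le> h * (h1 * (n * T))" using that n T by (intro mult_left_mono mult_right_mono) auto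
    also have "\<dots> = h * t / 8" using n T by (simp add: h1_def)
    finally show ?thesis .
  qed
  \<comment> \<open>The quadratic term and \<open>J h\<close> take at most \<open>h t / 8\<close>
    each, so at least half of \<open>h t\<close> survives in the exponent.\<close>
  have good: "P \<le> exp (- h * t / 2)" if "0 < h" "h \<le> h1" "J h \<le> h * t / 8" for h
  proof -
    have "h\<^sup>2 * n * T0 + J h - h * t \<le> - h * t / 2"
      using quad[OF that(1,2)] that mult_pos_pos[OF that(1) t] by simp
    then show ?thesis using chernoff[OF that(1)] by (meson exp_le_cancel_iff order_trans)
  qed
  \<comment> \<open>If \<open>h t \<le> 8\<close>, no value below \<open>t / 8\<close> in modulus
    exceeds \<open>1 / h\<close>. This is what makes the halving terminate.\<close>
  have J0: "J h = 0" if "0 < h" "h * t \<le> 8" for h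
  proof -
    have "j h x = 0" for x
    proof (rule ccontr)
      assume "j h x \<noteq> 0"
      then have *: "1 < h * \<bar>x\<bar>" "\<bar>x\<bar> < t/8" by (auto simp: j_def split: if_splits)
      have "h * \<bar>x\<bar> \<le> h * (t/8)" using * that by (intro mult_left_mono) auto
      then show False using *(1) that(2) by linarith
    qed
    then show ?thesis by (simp add: J_def)
  qed
  define G where "G k \<longleftrightarrow> J (h1 / 2^k) \<le> (h1 / 2^k) * t / 8" for k :: nat
  obtain k1 :: nat where "h1 * t / 8 < 2 ^ k1" using real_arch_pow[of 2 "h1 * t / 8"] by auto
  then have "h1 / 2 ^ k1 * t \<le> 8" by (simp add: field_simps)
  then have "G k1" using J0[of "h1 / 2^k1"] h1 t by (simp add: G_def)
  define k where "k = (LEAST k. G k)"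
  have Gk: "G k" unfolding k_def by (rule LeastI, fact)
  define h where "h = h1 / 2 ^ k"
  have h: "0 < h" "h \<le> h1" using h1 by (auto simp: h_def field_simps)
  have Ph: "P \<le> exp (- h * t / 2)" using good[OF h] Gk by (simp add: G_def h_def)
  show ?thesis
  proof (cases "k = 0")
    case True
    have "- h * t / 2 = - t\<^sup>2 / (16 * n * T)" using True by (simp add: h_def h1_def power2_eq_square)
    then have "P \<le> exp (- t\<^sup>2 / (16 * n * T))" using Ph by (simp only:)
    then show ?thesis using w_nonneg unfolding P_def n_def m_def by linarith
  next
    case False
    then have nG: "\<not> G (k - 1)" unfolding k_def by (intro not_less_Least) simp
    have "h1 / 2 ^ (k - 1) = 2 * h" using False by (cases k) (auto simp: h_def)
    then have J2: "J (2 * h) > h * t / 4" using nG unfolding G_def by simp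
    \<comment> \<open>The parameter \<open>2 h\<close> was rejected, so \<open>J (2 h)\<close> is
      nonzero and \<open>2 h t > 8\<close>. Then \<open>J (2 h) > h t / 4 > 1\<close>, which allows
      the factor 1 to be replaced by \<open>J (2 h)\<close> below.\<close>
    have ht: "h * t > 4"
    proof (rule ccontr)
      assume "\<not> ?thesis"
      then have "J (2 * h) = 0" using h by (intro J0) auto
      then show False using J2 mult_pos_pos[OF h(1) t] by simp
    qed
    \<comment> \<open>Where \<open>j (2 h)\<close> is nonzero, |x| < t/8 gives
      \<open>2 h |x| \<le> h t / 4\<close>, and |x| > 1/(2h) gives
      \<open>(t/8) / |x| \<le> h t / 4\<close>. Of the exponent \<open>- h t / 2\<close>, one half
      cancels the growth and the other half supplies the weight. The level \<open>t / 8\<close>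
      makes these two halves match.\<close>
    have pt: "exp (- h * t / 2) * j (2 * h) x \<le> jump_weight (t/8) x" for x
    proof (cases "1 < 2 * h * \<bar>x\<bar> \<and> \<bar>x\<bar> < t/8")
      case True
      then have x: "x \<noteq> 0" by auto
      have 1: "2 * h * \<bar>x\<bar> \<le> h * t / 4"
        using mult_left_mono[of "\<bar>x\<bar>" "t/8" "2*h"] True h by simp
      have "(t / 8) * 1 \<le> (t / 8) * (2 * h * \<bar>x\<bar>)" using True t by (intro mult_left_mono) auto
      then have 2: "(t / 8) / \<bar>x\<bar> \<le> h * t / 4" using x by (simp add: divide_le_eq mult_ac)
      have "- h * t / 2 + 2 * h * \<bar>x\<bar> \<le> - (t/8) / \<bar>x\<bar>" using 1 2 by simp
      then show ?thesis using True x by (auto simp: j_def jump_weight_def simp flip: exp_add)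
    next
      case False
      then show ?thesis by (auto simp: j_def jump_weight_nonneg)
    qed
    have "exp (- h * t / 2) * 1 \<le> exp (- h * t / 2) * J (2 * h)"
      using J2 ht by (intro mult_left_mono) auto
    also have "\<dots> = n * expectation (\<lambda>\<omega>. exp (- h * t / 2) * j (2 * h) (Z0 \<omega>))"
      by (simp add: J_def)
    also have "\<dots> \<le> n * expectation (\<lambda>\<omega>. jump_weight (t/8) (Z0 \<omega>))"
      using n pt intw intj[of "2 * h"] h by (intro mult_left_mono integral_mono) auto
    finally have "P \<le> n * expectation (\<lambda>\<omega>. jump_weight (t/8) (Z0 \<omega>))" using Ph by simp
    then show ?thesis by (simp add: P_def n_def m_def add_increasing)
  qed
qed

text \<open>If the truncated second moment is 0, the previous bound holds for every
  \<open>s > 0\<close> in place of \<open>T\<close>, and letting \<open>s\<close> decrease to 0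
  removes the Gaussian term. An empty index set is separated first, because its zero denominator
  would turn that term into the constant 1.\<close>

lemma trunc_sum_upper:
  fixes Z :: "'i \<Rightarrow> 'a \<Rightarrow> real" and t T :: real
  assumes "finite I" and indep: "indep_vars (\<lambda>_. borel) Z I"
    and Z0: "random_variable borel Z0"
    and ident: "\<And>i. i \<in> I \<Longrightarrow> distr M borel (Z i) = distr M borel Z0"
    and t: "0 < t" and T: "T = expectation (\<lambda>\<omega>. (trunc (t/8) (Z0 \<omega>))\<^sup>2)"
  shows "\<P>(\<omega> in M. (\<Sum>i\<in>I. trunc (t/8) (Z i \<omega>)) \<ge> real (card I) * expectation (\<lambda>\<omega>. trunc (t/8) (Z0 \<omega>)) + t)
    \<le> (if T = 0 then 0 else exp (- t\<^sup>2 / (16 * real (card I) * T))) + real (card I) * expectation (\<lambda>\<omega>. jump_weight (t/8) (Z0 \<omega>))"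
    (is "?P \<le> _ + ?W")
proof -
  have "T \<ge> 0" unfolding T by (intro integral_nonneg_AE) auto
  consider "T > 0" | "T = 0" "card I = 0" | "T = 0" "card I > 0" using \<open>T \<ge> 0\<close> by force
  then show ?thesis
  proof cases
    case 1
    then show ?thesis using trunc_sum_upper_pos[OF assms(1-5) 1] T by simp
  next
    case 2
    then have "I = {}" using \<open>finite I\<close> by simp
    then show ?thesis using t 2 by simp
  next
    case 3
    define a where "a = t\<^sup>2 / (16 * real (card I))"
    have a: "a > 0" using 3 t by (simp add: a_def)
    have ev: "\<forall>\<^sub>F s in at_right 0. ?P \<le> exp (- a / s) + ?W"
      unfolding eventually_at_right_field
    proof (intro exI[of _ 1] conjI allI impI)
      fix s :: real assume "0 < s"
      then show "?P \<le> exp (- a / s) + ?W"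
        using trunc_sum_upper_pos[OF assms(1-5), of s] T 3 by (simp add: a_def field_simps)
    qed auto
    have "filterlim (\<lambda>s. - a * inverse s) at_bot (at_right (0::real))"
      by (rule filterlim_tendsto_neg_mult_at_bot[of _ "-a"])
         (use a in \<open>auto intro: filterlim_inverse_at_top_right\<close>)
    then have "((\<lambda>s. exp (- a / s)) \<longlongrightarrow> 0) (at_right (0::real))"
      by (intro filterlim_compose[OF exp_at_bot]) (simp add: divide_inverse)
    then have "((\<lambda>s. exp (- a / s) + ?W) \<longlongrightarrow> 0 + ?W) (at_right (0::real))"
      by (intro tendsto_intros)
    then have "?P \<le> 0 + ?W" by (rule tendsto_lowerbound) (use ev in auto)
    then show ?thesis using 3 by simp
  qed
qed

end

section \<open>Moment conditions and the normalising sequence\<close>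

definition thr :: "nat \<Rightarrow> real" where
  "thr n = sqrt (real n * ln (real n))"

lemma thr_pos: "2 \<le> n \<Longrightarrow> 0 < thr n"
  by (simp add: thr_def)

lemma thr_nonneg: "0 \<le> thr n"
  by (cases "n = 0") (simp_all add: thr_def)

lemma thr_sq: "(thr n)\<^sup>2 = real n * ln (real n)"
  by (cases "n = 0") (simp_all add: thr_def)

lemma thr_mono: "m \<le> n \<Longrightarrow> thr m \<le> thr n"
  by (cases "m = 0") (use thr_nonneg[of n] in \<open>auto simp: thr_def intro!: mult_mono\<close>)

lemma summable_on_from_2_iff:
  fixes f :: "nat \<Rightarrow> real"
  assumes "\<And>n. 0 \<le> f n"
  shows "f summable_on {2..} \<longleftrightarrow> summable f"
proof -
  define g where "g n = (if n \<ge> 2 then f n else 0)" for n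
  have "f summable_on {2..} \<longleftrightarrow> g summable_on UNIV"
    by (rule summable_on_cong_neutral) (auto simp: g_def)
  also have "\<dots> \<longleftrightarrow> summable g"
    by (rule summable_on_UNIV_nonneg_real_iff) (auto simp: g_def assms)
  also have "\<dots> \<longleftrightarrow> summable f"
    by (rule summable_cong, rule eventually_sequentiallyI[of 2]) (simp add: g_def)
  finally show ?thesis .
qed

text \<open>Telescoping: each term is at most \<open>1 / (n - 1) - 1 / n\<close>.\<close>

lemma sum_inverse_squares_tail:
  assumes "k \<ge> (1::nat)"
  shows "(\<Sum>n=k+1..<k+1+j. 1 / (real n)\<^sup>2) \<le> 1 / real k - 1 / real (k + j)"
proof (induction j)
  case (Suc j)
  have "1 / (real (k + 1 + j))\<^sup>2 \<le> 1 / real (k + j) - 1 / real (k + Suc j)"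
    using assms by (simp add: divide_simps power2_eq_square)
  then show ?case using Suc by simp
qed simp

lemma log_plus_pos: "0 \<le> x \<Longrightarrow> 0 < log_plus x"
  by (simp add: log_plus_def)

lemma log_plus_le: "0 \<le> x \<Longrightarrow> log_plus x \<le> 1 + x"
  using ln_le_minus_one[of "2 + x"] by (simp add: log_plus_def)

text \<open>Links (b) to the first moment: it makes \<open>X\<close> integrable, and it bounds |x|
  linearly in \<open>x^2 / log_plus |x|\<close>.\<close>

lemma sq_div_log_plus_ge: "\<bar>x\<bar> - 1 \<le> x\<^sup>2 / log_plus \<bar>x\<bar>"
proof -
  have "(\<bar>x\<bar> - 1) * (1 + \<bar>x\<bar>) \<le> x\<^sup>2" by (simp add: algebra_simps power2_eq_square)
  then have "\<bar>x\<bar> - 1 \<le> x\<^sup>2 / (1 + \<bar>x\<bar>)" by (simp add: pos_le_divide_eq)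
  also have "\<dots> \<le> x\<^sup>2 / log_plus \<bar>x\<bar>"
    using log_plus_le[of "\<bar>x\<bar>"] log_plus_pos[of "\<bar>x\<bar>"] by (intro divide_left_mono) auto
  finally show ?thesis .
qed

lemma sq_div_log_plus_nonneg: "0 \<le> x\<^sup>2 / log_plus \<bar>x\<bar>"
  using log_plus_pos[of "\<bar>x\<bar>"] by simp

text \<open>With \<open>m = x^2 / log_plus |x|\<close>, each of the roughly \<open>m\<close> indices
  up to \<open>m\<close> contributes at most 1. Beyond \<open>m\<close> the exponential decay yields
  terms of order \<open>m^2 / n^2\<close>, whose tail sum is again of order
  \<open>m\<close>.\<close>

lemma jump_weight_sum_bound:
  assumes c: "0 < c"
  shows "\<exists>C\<ge>0. \<forall>x N. (\<Sum>n=2..<N. jump_weight (c * thr n) x) \<le> C * (1 + x\<^sup>2 / log_plus \<bar>x\<bar>)"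
proof (intro exI conjI allI)
  \<comment> \<open>576 = 64 * 9: the 64 comes from \<open>z^4 / 64 \<le> exp z\<close>, the 9 from
    squaring \<open>log_plus |x| \<le> 3 ln n\<close>.\<close>
  define C1 where "C1 = 576 / c ^ 4"
  have C1: "C1 > 0" using c by (simp add: C1_def)
  show "0 \<le> 2 + C1" using C1 by simp
  fix x :: real and N :: nat
  show "(\<Sum>n=2..<N. jump_weight (c * thr n) x) \<le> (2 + C1) * (1 + x\<^sup>2 / log_plus \<bar>x\<bar>)"
  proof (cases "x = 0")
    case True
    then show ?thesis using C1 by (simp add: jump_weight_def)
  next
    case False
    define a where "a = \<bar>x\<bar>"
    define L where "L = log_plus a"
    define m where "m = a\<^sup>2 / L"
    have a: "a > 0" using False by (simp add: a_def)
    have L: "L > 0" using a log_plus_pos by (simp add: L_def)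
    have m: "m > 0" using a L by (simp add: m_def)
    define k where "k = nat \<lceil>m\<rceil>"
    have k: "real k \<ge> m" "real k \<le> m + 1" "k \<ge> 1" using m by (auto simp: k_def) linarith+
    \<comment> \<open>For \<open>n > m\<close> the index dominates \<open>a\<close> up to an
      additive constant, so \<open>log_plus a\<close> is at most \<open>3 ln n\<close>. This lets
      the \<open>ln n\<close> inside \<open>thr n\<close> be replaced by the logarithm in
      \<open>m\<close>.\<close>
    have tail: "jump_weight (c * thr n) x \<le> C1 * m\<^sup>2 * (1 / (real n)\<^sup>2)" if n: "n \<ge> 2" "real n > m" for n
    proof -
      have "a - 1 \<le> m" using sq_div_log_plus_ge[of x] by (simp add: m_def a_def L_def)
      then have "2 + a \<le> real n + 3" using n by simp
      also have "\<dots> \<le> real n ^ 3"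
      proof -
        have "4 * real n \<le> real n * real n * real n"
          using n mult_mono[of 2 "real n" 2 "real n"] by (intro mult_right_mono) auto
        then show ?thesis using n unfolding power3_eq_cube by linarith
      qed
      finally have "ln (2 + a) \<le> ln (real n ^ 3)" using a n by simp
      then have Ln: "L \<le> 3 * ln (real n)" using n by (simp add: L_def log_plus_def ln_realpow)
      define z where "z = c * thr n / a"
      have z: "z > 0" using a c thr_pos[OF n(1)] by (simp add: z_def)
      have "(z/2)\<^sup>2 / 2 \<le> exp (z/2)" using exp_lower_Taylor_quadratic[of "z/2"] z by simp
      then have "((z/2)\<^sup>2 / 2)\<^sup>2 \<le> (exp (z/2))\<^sup>2" by (intro power_mono) auto
      also have "(exp (z/2))\<^sup>2 = exp z" by (simp flip: exp_double)
      finally have "z ^ 4 / 64 \<le> exp z" by (simp add: power_divide)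
      then have "exp (- z) \<le> 64 / z ^ 4"
        using z by (simp add: exp_minus field_simps)
      also have "z ^ 4 = c ^ 4 * (real n * ln (real n))\<^sup>2 / a ^ 4"
      proof -
        have "z ^ 4 = c ^ 4 * ((thr n)\<^sup>2)\<^sup>2 / a ^ 4"
          unfolding z_def by (simp add: power_divide power_mult_distrib)
        then show ?thesis by (simp only: thr_sq)
      qed
      also have "64 / (c ^ 4 * (real n * ln (real n))\<^sup>2 / a ^ 4) = 64 / c ^ 4 * a ^ 4 / (real n)\<^sup>2 * (1 / (ln (real n))\<^sup>2)"
        using c a n by (simp add: field_simps power_mult_distrib)
      also have "\<dots> \<le> 64 / c ^ 4 * a ^ 4 / (real n)\<^sup>2 * (9 / L\<^sup>2)"
      proof (intro mult_left_mono)
        have "L\<^sup>2 \<le> (3 * ln (real n))\<^sup>2" using Ln L by (intro power_mono) auto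
        then show "1 / (ln (real n))\<^sup>2 \<le> 9 / L\<^sup>2" using L n by (simp add: field_simps power_mult_distrib)
      qed (use c in auto)
      also have "\<dots> = C1 * m\<^sup>2 * (1 / (real n)\<^sup>2)" by (simp add: C1_def m_def power_divide)
      finally show ?thesis using False by (simp add: jump_weight_def z_def a_def)
    qed
    \<comment> \<open>The range is enlarged to two complete blocks, split at \<open>k\<close>; this
      only adds nonnegative terms.\<close>
    have "(\<Sum>n=2..<N. jump_weight (c * thr n) x) \<le>
        (\<Sum>n\<in>{..k} \<union> {k+1..<k+1+N}. if n \<le> k then 1 else C1 * m\<^sup>2 * (1 / (real n)\<^sup>2))"
    proof (rule order_trans[OF sum_mono])
      fix n assume "n \<in> {2..<N}"
      then show "jump_weight (c * thr n) x \<le> (if n \<le> k then 1 else C1 * m\<^sup>2 * (1 / (real n)\<^sup>2))"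
        using tail[of n] k c thr_nonneg[of n] by (auto intro!: jump_weight_le_1)
    next
      show "(\<Sum>n=2..<N. if n \<le> k then 1 else C1 * m\<^sup>2 * (1 / (real n)\<^sup>2)) \<le>
        (\<Sum>n\<in>{..k} \<union> {k+1..<k+1+N}. if n \<le> k then 1 else C1 * m\<^sup>2 * (1 / (real n)\<^sup>2))"
        using C1 by (intro sum_mono2) auto
    qed
    also have "\<dots> = (\<Sum>n\<le>k. 1) + (\<Sum>n=k+1..<k+1+N. C1 * m\<^sup>2 * (1 / (real n)\<^sup>2))"
      by (subst sum.union_disjoint) (auto intro!: arg_cong2[of _ _ _ _ "(+)"] sum.cong)
    also have "\<dots> \<le> (m + 2) + C1 * m"
    proof (rule add_mono)
      show "(\<Sum>n\<le>k. 1::real) \<le> m + 2" using k by simp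
      have "(\<Sum>n=k+1..<k+1+N. C1 * m\<^sup>2 * (1 / (real n)\<^sup>2)) = C1 * m\<^sup>2 * (\<Sum>n=k+1..<k+1+N. 1 / (real n)\<^sup>2)"
        by (simp only: sum_distrib_left)
      also have "\<dots> \<le> C1 * m\<^sup>2 * (1 / m)"
      proof (intro mult_left_mono)
        have "1 / real k \<le> 1 / m" using k m by (intro divide_left_mono) auto
        moreover have "0 \<le> 1 / real (k + N)" by simp
        ultimately show "(\<Sum>n=k+1..<k+1+N. 1 / (real n)\<^sup>2) \<le> 1 / m"
          using sum_inverse_squares_tail[OF k(3), of N] by linarith
      qed (use C1 in auto)
      also have "\<dots> = C1 * m" using m by (simp add: power2_eq_square)
      finally show "(\<Sum>n=k+1..<k+1+N. C1 * m\<^sup>2 * (1 / (real n)\<^sup>2)) \<le> C1 * m" .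
    qed
    also have "\<dots> \<le> (2 + C1) * (1 + m)" using C1 m by (simp add: algebra_simps)
    finally show ?thesis by (simp add: m_def L_def a_def)
  qed
qed

text \<open>The converse count: about \<open>x^2 / (2 log_plus |x|)\<close> thresholds lie below
  |x|. For \<open>k\<close> of this size, \<open>k \<le> (2 + |x|)^2\<close> and hence
  \<open>ln k \<le> 2 log_plus |x|\<close>, so that \<open>k ln k \<le> x^2\<close>.\<close>

lemma sq_div_log_plus_count:
  "\<exists>k::nat. x\<^sup>2 / log_plus \<bar>x\<bar> \<le> 2 * real k + 2 \<and> (\<forall>n\<in>{2..k}. thr n \<le> \<bar>x\<bar>)"
proof -
  define a where "a = \<bar>x\<bar>"
  define L where "L = log_plus a"
  have a: "a \<ge> 0" by (simp add: a_def)
  have L: "L > 0" using a log_plus_pos by (simp add: L_def)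
  define k where "k = nat \<lfloor>a\<^sup>2 / (2 * L)\<rfloor>"
  have nn: "0 \<le> a\<^sup>2 / (2 * L)" using L by simp
  then have k: "real k \<le> a\<^sup>2 / (2 * L)" "a\<^sup>2 / (2 * L) \<le> real k + 1" unfolding k_def by linarith+
  have "x\<^sup>2 / log_plus \<bar>x\<bar> \<le> 2 * real k + 2"
    using k(2) by (simp add: a_def L_def)
  moreover have "thr n \<le> \<bar>x\<bar>" if n: "n \<in> {2..k}" for n
  proof -
    have "ln 2 \<le> L" using a by (simp add: L_def log_plus_def)
    then have "1 \<le> 2 * L" using ln2_ge_two_thirds by simp
    then have "a\<^sup>2 / (2 * L) \<le> a\<^sup>2" by (simp add: divide_le_eq mult_le_cancel_left1)
    moreover have "a\<^sup>2 \<le> (2 + a)\<^sup>2" using a by (intro power_mono) auto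
    ultimately have "real k \<le> (2 + a)\<^sup>2" using k(1) by linarith
    then have "ln (real k) \<le> ln ((2 + a)\<^sup>2)" using n a by simp
    then have lnk: "ln (real k) \<le> 2 * L" using a by (simp add: L_def log_plus_def ln_realpow)
    have "real n * ln (real n) \<le> real k * ln (real k)"
      using n by (intro mult_mono) auto
    also have "\<dots> \<le> a\<^sup>2 / (2 * L) * (2 * L)"
      using k(1) lnk n nn by (intro mult_mono) auto
    also have "\<dots> = a\<^sup>2" using L by simp
    finally have "thr n \<le> sqrt (a\<^sup>2)" unfolding thr_def by (rule real_sqrt_le_mono)
    then show ?thesis by (simp add: a_def)
  qed
  ultimately show ?thesis by blast
qed

context prob_space
begin

lemma trunc_second_moment_eq:
  "trunc_second_moment M Y \<epsilon> n = expectation (\<lambda>\<omega>. (trunc (\<epsilon> * thr n) (Y \<omega>))\<^sup>2)"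
  unfolding trunc_second_moment_def
  by (intro Bochner_Integration.integral_cong) (auto simp: trunc_def thr_def indicator_def)

lemma trunc_second_moment_nonneg: "0 \<le> trunc_second_moment M Y \<epsilon> n"
  unfolding trunc_second_moment_eq by (intro integral_nonneg_AE) auto

text \<open>On the event in question the weight is at least exp (-1), which is at least 1/3.\<close>

lemma prob_large_le_jump_weight:
  assumes [measurable]: "random_variable borel Y" and y: "0 < y"
  shows "\<P>(\<omega> in M. \<bar>Y \<omega>\<bar> \<ge> y) \<le> 3 * expectation (\<lambda>\<omega>. jump_weight y (Y \<omega>))"
proof -
  have "\<P>(\<omega> in M. \<bar>Y \<omega>\<bar> \<ge> y) \<le> expectation (\<lambda>\<omega>. 3 * jump_weight y (Y \<omega>)) / 1"
  proof (rule order_trans[OF _ integral_Markov_inequality_measure[where A = "{}"]])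
    show "\<P>(\<omega> in M. \<bar>Y \<omega>\<bar> \<ge> y) \<le> \<P>(\<omega> in M. 1 \<le> 3 * jump_weight y (Y \<omega>))"
    proof (rule finite_measure_mono)
      show "{\<omega> \<in> space M. y \<le> \<bar>Y \<omega>\<bar>} \<subseteq> {\<omega> \<in> space M. 1 \<le> 3 * jump_weight y (Y \<omega>)}"
      proof safe
        fix \<omega> assume *: "y \<le> \<bar>Y \<omega>\<bar>"
        then have "y / \<bar>Y \<omega>\<bar> \<le> 1" using y by (simp add: divide_le_eq)
        then have "exp (- 1) \<le> exp (- y / \<bar>Y \<omega>\<bar>)" by simp
        moreover have "1 \<le> 3 * exp (- 1 :: real)" using exp_le by (simp add: exp_minus field_simps)
        ultimately have "1 \<le> 3 * exp (- y / \<bar>Y \<omega>\<bar>)" by linarith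
        then show "1 \<le> 3 * jump_weight y (Y \<omega>)" using * y by (auto simp: jump_weight_def)
      qed
    qed measurable
  qed (use y assms(1) in \<open>auto intro!: integrable_jump_weight simp: jump_weight_nonneg\<close>)
  then show ?thesis by simp
qed

lemma summable_jump_weight:
  assumes [measurable]: "random_variable borel Y"
    and int: "integrable M (\<lambda>\<omega>. (Y \<omega>)\<^sup>2 / log_plus \<bar>Y \<omega>\<bar>)" and c: "0 < c"
  shows "summable (\<lambda>n. expectation (\<lambda>\<omega>. jump_weight (c * thr n) (Y \<omega>)))"
proof -
  obtain C where C: "C \<ge> 0" "\<And>x N. (\<Sum>n=2..<N. jump_weight (c * thr n) x) \<le> C * (1 + x\<^sup>2 / log_plus \<bar>x\<bar>)"
    using jump_weight_sum_bound[OF c] by blast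
  \<comment> \<open>The pointwise bound on the summed weights starts at index 2, so the first two
    terms are masked; this does not affect convergence.\<close>
  define a where "a n = (if n \<ge> 2 then expectation (\<lambda>\<omega>. jump_weight (c * thr n) (Y \<omega>)) else 0)" for n
  have ij: "integrable M (\<lambda>\<omega>. jump_weight (c * thr n) (Y \<omega>))" for n
    using c thr_nonneg[of n] by (intro integrable_jump_weight) auto
  have "summable a"
  proof (rule bounded_imp_summable)
    show "0 \<le> a n" for n unfolding a_def by (auto intro!: integral_nonneg_AE simp: jump_weight_nonneg)
    fix N
    have "(\<Sum>n\<le>N. a n) = (\<Sum>n=2..<Suc N. expectation (\<lambda>\<omega>. jump_weight (c * thr n) (Y \<omega>)))"
      unfolding a_def by (rule sum.mono_neutral_cong_right) auto
    also have "\<dots> = expectation (\<lambda>\<omega>. \<Sum>n=2..<Suc N. jump_weight (c * thr n) (Y \<omega>))"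
      using ij by (intro Bochner_Integration.integral_sum [symmetric])
    also have "\<dots> \<le> expectation (\<lambda>\<omega>. C * (1 + (Y \<omega>)\<^sup>2 / log_plus \<bar>Y \<omega>\<bar>))"
      using ij int C(2)
      by (intro integral_mono integrable_sum integrable_mult_right integrable_add)
         (auto simp del: sum.op_ivl_Suc)
    finally show "(\<Sum>n\<le>N. a n) \<le> expectation (\<lambda>\<omega>. C * (1 + (Y \<omega>)\<^sup>2 / log_plus \<bar>Y \<omega>\<bar>))" .
  qed
  moreover have "summable a \<longleftrightarrow> summable (\<lambda>n. expectation (\<lambda>\<omega>. jump_weight (c * thr n) (Y \<omega>)))"
    by (rule summable_cong, rule eventually_sequentiallyI[of 2]) (simp add: a_def)
  ultimately show ?thesis by blast
qed

lemma integrable_of_sq_div_log_plus: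
  assumes [measurable]: "random_variable borel Y"
    and int: "integrable M (\<lambda>\<omega>. (Y \<omega>)\<^sup>2 / log_plus \<bar>Y \<omega>\<bar>)"
  shows "integrable M Y"
proof (rule Bochner_Integration.integrable_bound[of _ "\<lambda>\<omega>. 1 + (Y \<omega>)\<^sup>2 / log_plus \<bar>Y \<omega>\<bar>"])
  have "\<bar>x\<bar> \<le> \<bar>1 + x\<^sup>2 / log_plus \<bar>x\<bar>\<bar>" for x :: real
    using sq_div_log_plus_ge[of x] sq_div_log_plus_nonneg[of x] by linarith
  then show "AE \<omega> in M. norm (Y \<omega>) \<le> norm (1 + (Y \<omega>)\<^sup>2 / log_plus \<bar>Y \<omega>\<bar>)" by simp
qed (use int in auto)

end

section \<open>Sufficiency\<close>

locale iid_sequence = prob_space +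
  fixes X :: "nat \<Rightarrow> 'a \<Rightarrow> real"
  assumes indep: "indep_vars (\<lambda>_. borel) X {1..}"
    and ident: "\<And>i. 1 \<le> i \<Longrightarrow> distr M borel (X i) = distr M borel (X 1)"
begin

lemma rv: "1 \<le> i \<Longrightarrow> random_variable borel (X i)"
  using indep by (auto simp: indep_vars_def)

lemma rv1 [measurable]: "random_variable borel (X 1)"
  by (rule rv) simp

lemmas rv1_Suc [measurable] = rv1[unfolded One_nat_def]

lemma partial_sum_measurable [measurable]: "random_variable borel (partial_sum X n)"
proof -
  have "random_variable borel (\<lambda>\<omega>. \<Sum>i=1..n. X i \<omega>)"
    by (rule borel_measurable_sum) (use rv in auto)
  then show ?thesis by (simp add: partial_sum_def[abs_def])
qed

text \<open>The one-sided bound is used for the summands and for their negatives, which share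
  \<open>T\<close> and \<open>W\<close> and have opposite means. Unless some summand reaches the
  truncation level, truncation changes nothing; that exceptional event costs \<open>3 n W\<close>,
  whence the factor 5.\<close>

lemma partial_sum_upper:
  assumes n: "2 \<le> n" and \<epsilon>: "0 < \<epsilon>"
  defines "m \<equiv> expectation (\<lambda>\<omega>. trunc (\<epsilon>/8 * thr n) (X 1 \<omega>))"
    and "T \<equiv> trunc_second_moment M (X 1) (\<epsilon>/8) n"
    and "W \<equiv> expectation (\<lambda>\<omega>. jump_weight (\<epsilon>/8 * thr n) (X 1 \<omega>))"
  shows "\<P>(\<omega> in M. \<bar>partial_sum X n \<omega> - real n * m\<bar> \<ge> \<epsilon> * thr n) \<le> 2 * real n * tail_term (\<epsilon>/8) T n + 5 * real n * W"
proof -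
  define t where "t = \<epsilon> * thr n"
  define y where "y = t / 8"
  have y_eq: "y = \<epsilon>/8 * thr n" by (simp add: y_def t_def)
  have t: "t > 0" and y: "y > 0" using \<epsilon> thr_pos[OF n] by (simp_all add: t_def y_def)
  define G where "G = (if T = 0 then 0 else exp (- t\<^sup>2 / (16 * real n * T)))"
  have T: "T = expectation (\<lambda>\<omega>. (trunc y (X 1 \<omega>))\<^sup>2)" unfolding T_def trunc_second_moment_eq y_eq ..
  have W: "W = expectation (\<lambda>\<omega>. jump_weight y (X 1 \<omega>))" unfolding W_def y_eq ..
  have m: "m = expectation (\<lambda>\<omega>. trunc y (X 1 \<omega>))" unfolding m_def y_eq ..
  define A where "A = {\<omega> \<in> space M. (\<Sum>i=1..n. trunc y (X i \<omega>)) \<ge> n * m + t}"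
  define B where "B = {\<omega> \<in> space M. (\<Sum>i=1..n. trunc y (- X i \<omega>)) \<ge> n * (- m) + t}"
  define E where "E i = {\<omega> \<in> space M. \<bar>X i \<omega>\<bar> \<ge> y}" for i
  have Xrv [measurable]: "random_variable borel (X i)" if "i \<in> {1..n}" for i using that rv by auto
  have [measurable]: "A \<in> events" "B \<in> events" unfolding A_def B_def by measurable
  have E_ev: "E i \<in> events" if "i \<in> {1..n}" for i
    using Xrv[OF that] unfolding E_def by measurable
  have ind: "indep_vars (\<lambda>_. borel) X {1..n}" by (rule indep_vars_subset[OF indep]) auto
  have ind': "indep_vars (\<lambda>_. borel) (\<lambda>i \<omega>. - X i \<omega>) {1..n}"
    by (rule indep_vars_compose2[OF ind, of "\<lambda>_. uminus"]) simp
  have ident': "distr M borel (\<lambda>\<omega>. - X i \<omega>) = distr M borel (\<lambda>\<omega>. - X 1 \<omega>)" if "i \<in> {1..n}" for i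
  proof -
    have "distr (distr M borel (X i)) borel uminus = distr (distr M borel (X 1)) borel uminus"
      using ident[of i] that by simp
    then show ?thesis using rv[of i] rv1 that by (simp add: distr_distr comp_def)
  qed
  have identn: "distr M borel (X i) = distr M borel (X 1)" if "i \<in> {1..n}" for i
    using ident[of i] that by simp
  have rv1': "random_variable borel (\<lambda>\<omega>. - X 1 \<omega>)" by measurable
  have card: "card {1..n} = n" by simp
  have mB: "expectation (\<lambda>\<omega>. trunc y (- X 1 \<omega>)) = - m"
    and TB: "expectation (\<lambda>\<omega>. (trunc y (- X 1 \<omega>))\<^sup>2) = T"
    and WB: "expectation (\<lambda>\<omega>. jump_weight y (- X 1 \<omega>)) = W"
    by (simp_all add: trunc_minus jump_weight_minus m T W)
  have "prob A \<le> G + real n * W"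
    using trunc_sum_upper[OF finite_atLeastAtMost ind rv1 identn t refl]
    by (simp only: card A_def G_def y_def [symmetric] T [symmetric] W [symmetric] m [symmetric] simp_thms)
  moreover have "prob B \<le> G + real n * W"
    using trunc_sum_upper[OF finite_atLeastAtMost ind' rv1' ident' t refl]
    by (simp only: card B_def G_def y_def [symmetric] mB TB WB simp_thms)
  moreover have "prob (\<Union>i\<in>{1..n}. E i) \<le> 3 * real n * W"
  proof -
    have "prob (\<Union>i\<in>{1..n}. E i) \<le> (\<Sum>i\<in>{1..n}. prob (E i))"
      using E_ev by (intro finite_measure_subadditive_finite) auto
    also have "\<dots> \<le> (\<Sum>i\<in>{1..n}. 3 * W)"
    proof (rule sum_mono)
      fix i assume i: "i \<in> {1..n}"
      have "prob (E i) \<le> 3 * expectation (\<lambda>\<omega>. jump_weight y (X i \<omega>))"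
        unfolding E_def by (rule prob_large_le_jump_weight[OF Xrv[OF i] y])
      also have "expectation (\<lambda>\<omega>. jump_weight y (X i \<omega>)) = W"
        unfolding W using i by (intro expectation_ident Xrv rv1 ident) auto
      finally show "prob (E i) \<le> 3 * W" .
    qed
    finally show ?thesis by simp
  qed
  moreover have "{\<omega> \<in> space M. \<bar>partial_sum X n \<omega> - real n * m\<bar> \<ge> t} \<subseteq> A \<union> B \<union> (\<Union>i\<in>{1..n}. E i)"
  proof
    fix \<omega> assume \<omega>: "\<omega> \<in> {\<omega> \<in> space M. \<bar>partial_sum X n \<omega> - real n * m\<bar> \<ge> t}"
    show "\<omega> \<in> A \<union> B \<union> (\<Union>i\<in>{1..n}. E i)"
    proof (rule ccontr)
      assume c: "\<omega> \<notin> A \<union> B \<union> (\<Union>i\<in>{1..n}. E i)"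
      then have "trunc y (X i \<omega>) = X i \<omega>" if "i \<in> {1..n}" for i
        using that \<omega> by (force simp: E_def trunc_def)
      then have "(\<Sum>i=1..n. trunc y (X i \<omega>)) = partial_sum X n \<omega>"
        by (simp add: partial_sum_def)
      then show False using c \<omega> by (auto simp: A_def B_def trunc_minus sum_negf)
    qed
  qed
  then have "\<P>(\<omega> in M. \<bar>partial_sum X n \<omega> - real n * m\<bar> \<ge> t) \<le> prob (A \<union> B \<union> (\<Union>i\<in>{1..n}. E i))"
    using E_ev by (intro finite_measure_mono) auto
  moreover have "\<dots> \<le> prob A + prob B + prob (\<Union>i\<in>{1..n}. E i)"
    using E_ev by (intro order_trans[OF measure_Un_le] add_mono measure_Un_le order_refl) auto
  ultimately have "\<P>(\<omega> in M. \<bar>partial_sum X n \<omega> - real n * m\<bar> \<ge> t) \<le> 2 * G + 5 * real n * W" by simp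
  moreover have "G \<le> real n * tail_term (\<epsilon>/8) T n"
  proof (cases "T = 0")
    case False
    then have Tpos: "T > 0" using trunc_second_moment_nonneg[of "X 1" "\<epsilon>/8" n] by (simp add: T_def)
    have "G = exp (- (\<epsilon>\<^sup>2 / (16 * T)) * ln (real n))"
      using False n by (simp add: G_def t_def power_mult_distrib thr_sq field_simps)
    also have "\<dots> \<le> exp (- ((\<epsilon>/8)\<^sup>2 / T) * ln (real n))"
    proof -
      \<comment> \<open>The Gaussian exponent has the constant 1/16. It is weakened to 1/64 so that
        the truncation level and the exponent carry the same parameter \<open>\<epsilon>/8\<close>,
        as (c) requires.\<close>
      have "(\<epsilon>/8)\<^sup>2 / T \<le> \<epsilon>\<^sup>2 / (16 * T)" using Tpos by (simp add: field_simps)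
      then have "(\<epsilon>/8)\<^sup>2 / T * ln (real n) \<le> \<epsilon>\<^sup>2 / (16 * T) * ln (real n)"
        using n by (intro mult_right_mono) auto
      then show ?thesis by (simp only: exp_le_cancel_iff mult_minus_left neg_le_iff_le)
    qed
    also have "\<dots> = real n * tail_term (\<epsilon>/8) T n"
    proof -
      have "real n * real n powr (- 1 - (\<epsilon>/8)\<^sup>2 / T) = real n powr (1 + (- 1 - (\<epsilon>/8)\<^sup>2 / T))"
        using n by (subst powr_add) simp
      then show ?thesis using False n by (simp add: tail_term_def powr_def)
    qed
    finally show ?thesis .
  qed (simp add: G_def tail_term_def)
  ultimately show ?thesis unfolding t_def by linarith
qed

end

section \<open>Truncated means of centred variables\<close>

text \<open>This is the monotone decrease of \<open>log_plus x / x\<close>: the tangent bound for ln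
  controls the increase of \<open>log_plus\<close> from \<open>y\<close> to \<open>a\<close>, and
  \<open>y / (2 + y) \<le> log_plus y\<close> absorbs the slope.\<close>

lemma log_plus_mult_le:
  assumes "0 < y" "y \<le> a"
  shows "y * log_plus a \<le> a * log_plus y"
proof -
  have "(2 + a) / (2 + y) = 1 + (a - y) / (2 + y)" using assms by (simp add: field_simps)
  moreover have "ln ((2 + a) / (2 + y)) \<le> (2 + a) / (2 + y) - 1"
    using assms by (intro ln_le_minus_one) simp
  moreover have "ln ((2 + a) / (2 + y)) = log_plus a - log_plus y"
    using assms by (simp add: log_plus_def ln_div)
  ultimately have "log_plus a \<le> log_plus y + (a - y) / (2 + y)" by simp
  then have "y * log_plus a \<le> y * (log_plus y + (a - y) / (2 + y))"
    using assms by (intro mult_left_mono) auto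
  also have "\<dots> = y * log_plus y + (a - y) * (y / (2 + y))" by (simp add: distrib_left)
  also have "\<dots> \<le> y * log_plus y + (a - y) * log_plus y"
  proof (intro add_left_mono mult_left_mono)
    have "1 - 1 / (2 + y) \<le> log_plus y"
      using ln_le_minus_one[of "1 / (2 + y)"] assms by (simp add: log_plus_def ln_div)
    moreover have "y / (2 + y) \<le> 1 - 1 / (2 + y)" using assms by (simp add: field_simps)
    ultimately show "y / (2 + y) \<le> log_plus y" by linarith
  qed (use assms in auto)
  finally show ?thesis by (simp add: algebra_simps)
qed

lemma eventually_log_plus_thr_le:
  assumes "0 < \<delta>"
  shows "\<forall>\<^sub>F n in sequentially. log_plus (\<delta> * thr n) \<le> ln (real n)"
proof -
  have "\<forall>\<^sub>F n in sequentially. 2 + \<delta> * sqrt (real n * ln (real n)) \<le> real n"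
    using assms by real_asymp
  moreover have "\<forall>\<^sub>F n in sequentially. (1::nat) \<le> n" by (rule eventually_ge_at_top)
  ultimately show ?thesis
  proof eventually_elim
    case (elim n)
    have "0 < 2 + \<delta> * thr n" using assms thr_nonneg[of n] by (simp add: add_pos_nonneg)
    then show ?case using elim by (simp add: log_plus_def thr_def)
  qed
qed

lemma filterlim_thr: "0 < \<delta> \<Longrightarrow> filterlim (\<lambda>n. \<delta> * thr n) at_top sequentially"
  unfolding thr_def by real_asymp

context prob_space
begin

text \<open>Since the full mean is 0, the truncated mean is minus the mean of the discarded part.
  There |x| is at most \<open>log_plus y / y\<close> times \<open>f x\<close>, and the expectation
  of \<open>f\<close> over the discarded part tends to 0 by dominated convergence.\<close>

lemma truncated_mean_small:
  assumes [measurable]: "random_variable borel Y"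
    and int: "integrable M (\<lambda>\<omega>. (Y \<omega>)\<^sup>2 / log_plus \<bar>Y \<omega>\<bar>)" and zero: "expectation Y = 0"
    and \<delta>: "0 < \<delta>" and \<eta>: "0 < \<eta>"
  shows "\<forall>\<^sub>F n in sequentially. real n * \<bar>expectation (\<lambda>\<omega>. trunc (\<delta> * thr n) (Y \<omega>))\<bar> \<le> \<eta> * thr n"
proof -
  define f where "f x = x\<^sup>2 / log_plus \<bar>x\<bar>" for x :: real
  have [measurable]: "f \<in> borel_measurable borel" unfolding f_def log_plus_def by measurable
  define r where "r n x = (if \<bar>x\<bar> \<ge> \<delta> * thr n then f x else 0)" for n x
  have [measurable]: "r n \<in> borel_measurable borel" for n unfolding r_def by measurable
  have f0: "0 \<le> f x" for x unfolding f_def by (rule sq_div_log_plus_nonneg)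
  have intf: "integrable M (\<lambda>\<omega>. f (Y \<omega>))" using int by (simp add: f_def)
  have intr: "integrable M (\<lambda>\<omega>. r n (Y \<omega>))" for n
    by (rule Bochner_Integration.integrable_bound[OF intf]) (use f0 in \<open>auto simp: r_def\<close>)
  have intY: "integrable M Y" by (rule integrable_of_sq_div_log_plus[OF assms(1) int])
  have "(\<lambda>n. expectation (\<lambda>\<omega>. r n (Y \<omega>))) \<longlonglongrightarrow> expectation (\<lambda>\<omega>. 0)"
  proof (rule integral_dominated_convergence[where w = "\<lambda>\<omega>. f (Y \<omega>)"])
    have "(\<lambda>n. r n x) \<longlonglongrightarrow> 0" for x
    proof (rule tendsto_eventually)
      have "\<forall>\<^sub>F n in sequentially. \<bar>x\<bar> < \<delta> * thr n"
        using filterlim_thr[OF \<delta>] by (simp add: filterlim_at_top_dense)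
      then show "\<forall>\<^sub>F n in sequentially. r n x = 0"
        by eventually_elim (simp add: r_def)
    qed
    then show "AE \<omega> in M. (\<lambda>n. r n (Y \<omega>)) \<longlonglongrightarrow> 0" by simp
  qed (use intf f0 in \<open>auto simp: r_def\<close>)
  then have "(\<lambda>n. expectation (\<lambda>\<omega>. r n (Y \<omega>))) \<longlonglongrightarrow> 0" by simp
  \<comment> \<open>The bound \<open>\<delta> * \<eta>\<close> is chosen because
    \<open>n ln n / (\<delta> thr n)\<close> equals \<open>thr n / \<delta>\<close>.\<close>
  then have ev: "\<forall>\<^sub>F n in sequentially. expectation (\<lambda>\<omega>. r n (Y \<omega>)) < \<delta> * \<eta>"
    using \<delta> \<eta> by (intro order_tendstoD) auto
  show ?thesis
    using ev eventually_log_plus_thr_le[OF \<delta>] eventually_ge_at_top[of 2]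
  proof eventually_elim
    case (elim n)
    define y where "y = \<delta> * thr n"
    define R where "R = expectation (\<lambda>\<omega>. r n (Y \<omega>))"
    have y: "y > 0" using \<delta> thr_pos elim by (simp add: y_def)
    have R0: "R \<ge> 0" unfolding R_def using f0 by (intro integral_nonneg_AE) (auto simp: r_def)
    have pt: "\<bar>x - trunc y x\<bar> \<le> log_plus y / y * r n x" for x
    proof (cases "\<bar>x\<bar> < y")
      case True
      then show ?thesis by (simp add: trunc_def r_def y_def)
    next
      case False
      have "\<bar>x\<bar> * (y * log_plus \<bar>x\<bar>) \<le> \<bar>x\<bar> * (\<bar>x\<bar> * log_plus y)"
        using log_plus_mult_le[of y "\<bar>x\<bar>"] y False by (intro mult_left_mono) auto
      then have "\<bar>x\<bar> \<le> log_plus y / y * f x"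
        using y log_plus_pos[of "\<bar>x\<bar>"] by (simp add: f_def field_simps power2_eq_square)
      then show ?thesis using False by (simp add: trunc_def r_def y_def)
    qed
    have "expectation (\<lambda>\<omega>. trunc y (Y \<omega>)) = - expectation (\<lambda>\<omega>. Y \<omega> - trunc y (Y \<omega>))"
      using intY zero by (subst Bochner_Integration.integral_diff) auto
    then have "\<bar>expectation (\<lambda>\<omega>. trunc y (Y \<omega>))\<bar> = \<bar>expectation (\<lambda>\<omega>. Y \<omega> - trunc y (Y \<omega>))\<bar>" by simp
    also have "\<dots> \<le> expectation (\<lambda>\<omega>. \<bar>Y \<omega> - trunc y (Y \<omega>)\<bar>)"
      using integral_norm_bound[of M "\<lambda>\<omega>. Y \<omega> - trunc y (Y \<omega>)"] by simp
    also have "\<dots> \<le> expectation (\<lambda>\<omega>. log_plus y / y * r n (Y \<omega>))"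
      using intY intr pt
      by (intro integral_mono integrable_abs Bochner_Integration.integrable_diff integrable_trunc
          integrable_mult_right) (auto simp: mult_ac)
    also have "\<dots> = log_plus y / y * R" by (simp add: R_def)
    also have "\<dots> \<le> ln (real n) / y * (\<delta> * \<eta>)"
      using elim y R0 by (intro mult_mono divide_right_mono) (auto simp: R_def y_def)
    finally have "real n * \<bar>expectation (\<lambda>\<omega>. trunc y (Y \<omega>))\<bar> \<le> real n * (ln (real n) / y * (\<delta> * \<eta>))"
      by (intro mult_left_mono) auto
    also have "\<dots> = \<eta> * ((thr n)\<^sup>2 / thr n)"
      using y \<delta> unfolding thr_sq by (simp add: y_def)
    also have "\<dots> = \<eta> * thr n" by (simp add: power2_eq_square)
    finally show ?case by (simp add: y_def)
  qed
qed

end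

section \<open>Convergence of the series from the moment conditions\<close>

context iid_sequence
begin

text \<open>Half of \<open>\<epsilon>\<close> pays for the truncated mean, the other half is left
  for the deviation from it. Condition (c) is therefore used at
  \<open>\<epsilon>/16\<close>.\<close>

theorem summable_of_moments:
  assumes int: "integrable M (\<lambda>\<omega>. (X 1 \<omega>)\<^sup>2 / log_plus \<bar>X 1 \<omega>\<bar>)"
    and zero: "expectation (X 1) = 0"
    and tails: "\<And>\<epsilon>. 0 < \<epsilon> \<Longrightarrow> summable (\<lambda>n. tail_term \<epsilon> (trunc_second_moment M (X 1) \<epsilon> n) n)"
    and \<epsilon>: "0 < \<epsilon>"
  shows "summable (\<lambda>n. \<P>(\<omega> in M. \<bar>partial_sum X n \<omega>\<bar> \<ge> \<epsilon> * thr n) / real n)"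
proof (rule summable_comparison_test_ev)
  define T where "T n = trunc_second_moment M (X 1) (\<epsilon>/2/8) n" for n
  define W where "W n = expectation (\<lambda>\<omega>. jump_weight (\<epsilon>/2/8 * thr n) (X 1 \<omega>))" for n
  show "summable (\<lambda>n. 2 * tail_term (\<epsilon>/2/8) (T n) n + 5 * W n)"
    unfolding T_def W_def using \<epsilon>
    by (intro summable_add summable_mult tails summable_jump_weight[OF rv1 int]) auto
  have "\<forall>\<^sub>F n in sequentially. real n * \<bar>expectation (\<lambda>\<omega>. trunc (\<epsilon>/2/8 * thr n) (X 1 \<omega>))\<bar> \<le> \<epsilon>/2 * thr n"
    using \<epsilon> by (intro truncated_mean_small[OF rv1 int zero]) auto
  then show "\<forall>\<^sub>F n in sequentially. norm (\<P>(\<omega> in M. \<bar>partial_sum X n \<omega>\<bar> \<ge> \<epsilon> * thr n) / real n)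
      \<le> 2 * tail_term (\<epsilon>/2/8) (T n) n + 5 * W n"
    using eventually_ge_at_top[of 2]
  proof eventually_elim
    case (elim n)
    define m where "m = expectation (\<lambda>\<omega>. trunc (\<epsilon>/2/8 * thr n) (X 1 \<omega>))"
    have "\<bar>real n * m\<bar> \<le> \<epsilon>/2 * thr n" using elim by (simp add: m_def abs_mult)
    then have "\<P>(\<omega> in M. \<bar>partial_sum X n \<omega>\<bar> \<ge> \<epsilon> * thr n) \<le> \<P>(\<omega> in M. \<bar>partial_sum X n \<omega> - real n * m\<bar> \<ge> \<epsilon>/2 * thr n)"
    proof (intro finite_measure_mono subsetI)
      fix \<omega> assume "\<omega> \<in> {\<omega> \<in> space M. \<bar>partial_sum X n \<omega>\<bar> \<ge> \<epsilon> * thr n}"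
      then have "\<omega> \<in> space M" "\<epsilon> * thr n \<le> \<bar>partial_sum X n \<omega>\<bar>" by auto
      moreover from this \<open>\<bar>real n * m\<bar> \<le> \<epsilon>/2 * thr n\<close>
      have "\<epsilon>/2 * thr n \<le> \<bar>partial_sum X n \<omega> - real n * m\<bar>" by argo
      ultimately show "\<omega> \<in> {\<omega> \<in> space M. \<bar>partial_sum X n \<omega> - real n * m\<bar> \<ge> \<epsilon>/2 * thr n}" by simp
    qed measurable
    also have "\<dots> \<le> 2 * real n * tail_term (\<epsilon>/2/8) (T n) n + 5 * real n * W n"
      unfolding T_def W_def m_def by (rule partial_sum_upper) (use elim(2) \<epsilon> in simp_all)
    also have "\<dots> = (2 * tail_term (\<epsilon>/2/8) (T n) n + 5 * W n) * real n" by (simp add: algebra_simps)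
    finally show ?case using elim by (simp add: divide_le_eq)
  qed
qed

end

section \<open>Symmetric summands\<close>

text \<open>Square \<open>1 + x/2 \<le> exp (x/2)\<close>; the hypothesis keeps the left side
  nonnegative.\<close>

lemma exp_ge_quarter_quadratic:
  fixes x :: real
  assumes "- 2 \<le> x"
  shows "1 + x + x\<^sup>2 / 4 \<le> exp x"
proof -
  have "(1 + x/2)\<^sup>2 \<le> (exp (x/2))\<^sup>2"
    using assms exp_ge_add_one_self[of "x/2"] by (intro power_mono) auto
  also have "(exp (x/2))\<^sup>2 = exp x" by (simp flip: exp_double)
  finally show ?thesis by (simp add: power2_eq_square field_simps)
qed

lemma exp_le_quadratic:
  fixes x :: real
  assumes "\<bar>x\<bar> \<le> 1"
  shows "exp x \<le> 1 + x + x\<^sup>2"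
  using exp_le_quadratic_plus_jump[of x] assms by simp

section \<open>Transfer of laws under independence; the second-moment method\<close>

context prob_space
begin

text \<open>The joint law is the product of the marginals. This justifies every later replacement of
  summands by sign-flipped or reindexed copies.\<close>

lemma distr_of_independent_eq:
  assumes U: "indep_vars (\<lambda>_. borel) U I" and V: "indep_vars (\<lambda>_. borel) V I" and "I \<noteq> {}"
    and eq: "\<And>i. i \<in> I \<Longrightarrow> distr M borel (U i) = distr M borel (V i)"
    and g: "g \<in> measurable (PiM I (\<lambda>_. borel)) N"
  shows "distr M N (\<lambda>\<omega>. g (\<lambda>i\<in>I. U i \<omega>)) = distr M N (\<lambda>\<omega>. g (\<lambda>i\<in>I. V i \<omega>))"
proof -
  let ?P = "PiM I (\<lambda>_. borel)"
  have rv: "random_variable borel (U i)" "random_variable borel (V i)" if "i \<in> I" for i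
    using U V that by (auto simp: indep_vars_def)
  have "distr M ?P (\<lambda>\<omega>. \<lambda>i\<in>I. U i \<omega>) = PiM I (\<lambda>i. distr M borel (U i))"
    using indep_vars_iff_distr_eq_PiM'[OF \<open>I \<noteq> {}\<close> rv(1)] U by simp
  also have "\<dots> = PiM I (\<lambda>i. distr M borel (V i))" by (intro PiM_cong eq refl)
  also have "\<dots> = distr M ?P (\<lambda>\<omega>. \<lambda>i\<in>I. V i \<omega>)"
    using indep_vars_iff_distr_eq_PiM'[OF \<open>I \<noteq> {}\<close> rv(2)] V by simp
  finally have "distr (distr M ?P (\<lambda>\<omega>. \<lambda>i\<in>I. U i \<omega>)) N g = distr (distr M ?P (\<lambda>\<omega>. \<lambda>i\<in>I. V i \<omega>)) N g"
    by simp
  moreover have "(\<lambda>\<omega>. \<lambda>i\<in>I. U i \<omega>) \<in> measurable M ?P" "(\<lambda>\<omega>. \<lambda>i\<in>I. V i \<omega>) \<in> measurable M ?P"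
    using rv by (auto intro!: measurable_restrict)
  ultimately show ?thesis using g by (simp add: distr_distr comp_def)
qed

lemma prob_of_independent_eq:
  assumes "indep_vars (\<lambda>_. borel) U I" "indep_vars (\<lambda>_. borel) V I" "I \<noteq> {}"
    and "\<And>i. i \<in> I \<Longrightarrow> distr M borel (U i) = distr M borel (V i)"
    and Q: "Measurable.pred (PiM I (\<lambda>_. borel)) Q"
  shows "\<P>(\<omega> in M. Q (\<lambda>i\<in>I. U i \<omega>)) = \<P>(\<omega> in M. Q (\<lambda>i\<in>I. V i \<omega>))"
proof -
  have *: "\<P>(\<omega> in M. Q (\<lambda>i\<in>I. W i \<omega>)) = measure (distr M (count_space UNIV) (\<lambda>\<omega>. Q (\<lambda>i\<in>I. W i \<omega>))) {True}"
    if "indep_vars (\<lambda>_. borel) W I" for W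
  proof -
    have "(\<lambda>\<omega>. \<lambda>i\<in>I. W i \<omega>) \<in> measurable M (PiM I (\<lambda>_. borel))"
      using that by (auto intro!: measurable_restrict simp: indep_vars_def)
    from measurable_compose[OF this Q] show ?thesis
      by (subst measure_distr) (auto intro!: arg_cong[of _ _ prob])
  qed
  show ?thesis
    unfolding *[OF assms(1)] *[OF assms(2)] using distr_of_independent_eq[OF assms(1-4) Q] by simp
qed

lemma prob_abs_sum_eq:
  fixes U V :: "'i \<Rightarrow> 'a \<Rightarrow> real"
  assumes "indep_vars (\<lambda>_. borel) U I" "indep_vars (\<lambda>_. borel) V I"
    and "\<And>i. i \<in> I \<Longrightarrow> distr M borel (U i) = distr M borel (V i)"
  shows "\<P>(\<omega> in M. \<bar>\<Sum>i\<in>I. U i \<omega>\<bar> \<ge> x) = \<P>(\<omega> in M. \<bar>\<Sum>i\<in>I. V i \<omega>\<bar> \<ge> x)"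
proof (cases "I = {}")
  case False
  have *: "Measurable.pred (PiM I (\<lambda>_. borel)) (\<lambda>f. \<bar>\<Sum>i\<in>I. f i\<bar> \<ge> x)" by measurable
  show ?thesis using prob_of_independent_eq[OF assms(1,2) False assms(3) *] by simp
qed simp

lemma indep_vars_inj_reindex:
  assumes X: "indep_vars (\<lambda>_. borel) X J" and \<sigma>: "inj_on \<sigma> I" "\<sigma> ` I \<subseteq> J"
  shows "indep_vars (\<lambda>_. borel) (\<lambda>i. X (\<sigma> i)) I"
proof -
  have "indep_vars (\<lambda>i. PiM {\<sigma> i} (\<lambda>_. borel)) (\<lambda>i \<omega>. restrict (\<lambda>j. X j \<omega>) {\<sigma> i}) I"
    using \<sigma> by (intro indep_vars_restrict[OF X]) (auto simp: disjoint_family_on_def inj_on_def)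
  then have "indep_vars (\<lambda>_. borel) (\<lambda>i \<omega>. (\<lambda>f. f (\<sigma> i)) (restrict (\<lambda>j. X j \<omega>) {\<sigma> i})) I"
    by (rule indep_vars_compose2) simp
  then show ?thesis by simp
qed

text \<open>Paley--Zygmund; when the second moment vanishes the bound is \<open>x / 0 = 0\<close>.\<close>

lemma prob_ge_half_mean:
  assumes int: "integrable M W" "integrable M (\<lambda>\<omega>. (W \<omega>)\<^sup>2)" and pos: "0 < expectation W"
  shows "(expectation W)\<^sup>2 / (4 * expectation (\<lambda>\<omega>. (W \<omega>)\<^sup>2)) \<le> \<P>(\<omega> in M. W \<omega> \<ge> expectation W / 2)"
proof (cases "expectation (\<lambda>\<omega>. (W \<omega>)\<^sup>2) = 0")
  case False
  define e where "e = expectation W"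
  define q where "q = expectation (\<lambda>\<omega>. (W \<omega>)\<^sup>2)"
  have "q \<ge> 0" unfolding q_def by (intro integral_nonneg_AE) auto
  moreover have "q \<noteq> 0" using False by (simp add: q_def)
  ultimately have q: "q > 0" by linarith
  have e: "e > 0" using pos by (simp add: e_def)
  define c where "c = e / (2 * q)"
  have c: "c > 0" using e q by (simp add: c_def)
  define A where "A = {\<omega> \<in> space M. W \<omega> \<ge> e / 2}"
  have [measurable]: "random_variable borel W" using int by auto
  have A: "A \<in> events" unfolding A_def by measurable
  \<comment> \<open>A pointwise inequality between arithmetic and geometric means takes the place of
    Cauchy--Schwarz. Integrated, it gives \<open>prob A \<ge> e c - c^2 q\<close>, and
    \<open>c = e / (2 q)\<close> maximises the right-hand side.\<close>
  have pt: "W \<omega> \<le> e / 2 + (c / 2 * (W \<omega>)\<^sup>2 + indicator A \<omega> / (2 * c))" if "\<omega> \<in> space M" for \<omega>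
  proof (cases "\<omega> \<in> A")
    case True
    have "0 \<le> (c * W \<omega> - 1)\<^sup>2 / (2 * c)" using c by simp
    also have "\<dots> = c / 2 * (W \<omega>)\<^sup>2 + 1 / (2 * c) - W \<omega>"
      using c by (simp add: power2_eq_square field_simps)
    finally show ?thesis using True e by simp
  next
    case False
    have "0 \<le> c / 2 * (W \<omega>)\<^sup>2" using c by simp
    moreover have "W \<omega> \<le> e / 2" using False that by (simp add: A_def)
    ultimately have "W \<omega> \<le> e / 2 + c / 2 * (W \<omega>)\<^sup>2" by linarith
    then show ?thesis using False by simp
  qed
  have intA: "integrable M (\<lambda>\<omega>. indicator A \<omega> / (2 * c))"
    using A by (intro integrable_divide_zero integrable_real_indicator) (auto simp: emeasure_eq_measure)
  have "e \<le> expectation (\<lambda>\<omega>. e / 2 + (c / 2 * (W \<omega>)\<^sup>2 + indicator A \<omega> / (2 * c)))"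
    unfolding e_def using int intA pt[unfolded e_def] by (intro integral_mono) auto
  also have "\<dots> = e / 2 + (c / 2 * q + prob A / (2 * c))"
    using int intA A by (simp add: q_def prob_space)
  also have "c / 2 * q = e / 4" using q by (simp add: c_def)
  finally have "e / 4 \<le> prob A / (2 * c)" by simp
  then have "e * c / 2 \<le> prob A" using c by (simp add: field_simps)
  moreover have "e * c / 2 = e\<^sup>2 / (4 * q)" by (simp add: c_def power2_eq_square)
  ultimately show ?thesis by (simp add: A_def e_def q_def)
qed simp

end

section \<open>Sign flips of symmetric summands\<close>

locale symmetric_iid_sequence = iid_sequence +
  assumes sym: "distr M borel (\<lambda>\<omega>. - X 1 \<omega>) = distr M borel (X 1)"
begin

lemma sym_i:
  assumes "1 \<le> i"
  shows "distr M borel (\<lambda>\<omega>. - X i \<omega>) = distr M borel (X i)"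
proof -
  have "distr (distr M borel (X i)) borel uminus = distr (distr M borel (X 1)) borel uminus"
    by (rule arg_cong[OF ident[OF assms]])
  then have "distr M borel (\<lambda>\<omega>. - X i \<omega>) = distr M borel (\<lambda>\<omega>. - X 1 \<omega>)"
    using rv[OF assms] rv1 by (simp add: distr_distr comp_def)
  then show ?thesis by (simp only: sym ident[OF assms])
qed

text \<open>The set of \<open>x\<close> with |x| >= y is invariant under reflection, so the part of
  a symmetric law on it is itself symmetric and may be reflected alone.\<close>

lemma distr_flip_large:
  assumes i: "1 \<le> i"
  shows "distr M borel (\<lambda>\<omega>. if \<bar>X i \<omega>\<bar> < y then X i \<omega> else - X i \<omega>) = distr M borel (X i)"
proof (rule measure_eqI)
  note [measurable] = rv[OF i]
  fix A assume "A \<in> sets (distr M borel (\<lambda>\<omega>. if \<bar>X i \<omega>\<bar> < y then X i \<omega> else - X i \<omega>))"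
  then have [measurable]: "A \<in> sets borel" by simp
  have flip: "\<P>(\<omega> in M. \<bar>X i \<omega>\<bar> \<ge> y \<and> - X i \<omega> \<in> A) = \<P>(\<omega> in M. \<bar>X i \<omega>\<bar> \<ge> y \<and> X i \<omega> \<in> A)"
    using prob_ident[OF _ rv[OF i] sym_i[OF i], of "{x \<in> A. \<bar>x\<bar> \<ge> y}"] by (simp add: conj_commute)
  have split: "\<P>(\<omega> in M. Q \<omega>) = \<P>(\<omega> in M. \<bar>X i \<omega>\<bar> < y \<and> Q \<omega>) + \<P>(\<omega> in M. \<bar>X i \<omega>\<bar> \<ge> y \<and> Q \<omega>)"
    if [measurable]: "Measurable.pred M Q" for Q
    by (subst finite_measure_Union [symmetric]) (auto intro!: arg_cong[of _ _ prob])
  have "\<P>(\<omega> in M. (if \<bar>X i \<omega>\<bar> < y then X i \<omega> else - X i \<omega>) \<in> A) = \<P>(\<omega> in M. X i \<omega> \<in> A)"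
    (is "?L = ?R")
  proof -
    have "?L = \<P>(\<omega> in M. \<bar>X i \<omega>\<bar> < y \<and> X i \<omega> \<in> A) + \<P>(\<omega> in M. \<bar>X i \<omega>\<bar> \<ge> y \<and> - X i \<omega> \<in> A)"
      by (subst split) (auto intro!: arg_cong2[of _ _ _ _ "(+)"] arg_cong[of _ _ prob])
    also have "\<dots> = ?R" unfolding flip by (rule split [symmetric]) measurable
    finally show ?thesis .
  qed
  then show "emeasure (distr M borel (\<lambda>\<omega>. if \<bar>X i \<omega>\<bar> < y then X i \<omega> else - X i \<omega>)) A = emeasure (distr M borel (X i)) A"
    by (subst (1 2) emeasure_distr) (auto simp: emeasure_eq_measure vimage_def Int_def conj_commute)
qed simp

text \<open>The original and the flipped summand add up to twice the truncated one. Hence if the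
  truncated sum reaches \<open>x\<close> in modulus, so does one of the two full sums, and these
  have the same law.\<close>

lemma prob_trunc_sum_le:
  "\<P>(\<omega> in M. \<bar>\<Sum>i=1..n. trunc y (X i \<omega>)\<bar> \<ge> x) \<le> 2 * \<P>(\<omega> in M. \<bar>partial_sum X n \<omega>\<bar> \<ge> x)"
proof -
  define X' where "X' i \<omega> = (if \<bar>X i \<omega>\<bar> < y then X i \<omega> else - X i \<omega>)" for i \<omega>
  have ind: "indep_vars (\<lambda>_. borel) X {1..n}" by (rule indep_vars_subset[OF indep]) auto
  have ind': "indep_vars (\<lambda>_. borel) X' {1..n}"
    unfolding X'_def by (rule indep_vars_compose2[OF ind, of "\<lambda>_ x. if \<bar>x\<bar> < y then x else - x"]) measurable
  have rvX [measurable]: "random_variable borel (X i)" "random_variable borel (X' i)" if "i \<in> {1..n}" for i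
    using that ind ind' by (auto simp: indep_vars_def)
  have "\<P>(\<omega> in M. \<bar>\<Sum>i=1..n. trunc y (X i \<omega>)\<bar> \<ge> x) \<le>
      prob ({\<omega> \<in> space M. \<bar>\<Sum>i=1..n. X i \<omega>\<bar> \<ge> x} \<union> {\<omega> \<in> space M. \<bar>\<Sum>i=1..n. X' i \<omega>\<bar> \<ge> x})"
  proof (rule finite_measure_mono)
    show "{\<omega> \<in> space M. \<bar>\<Sum>i=1..n. trunc y (X i \<omega>)\<bar> \<ge> x} \<subseteq>
      {\<omega> \<in> space M. \<bar>\<Sum>i=1..n. X i \<omega>\<bar> \<ge> x} \<union> {\<omega> \<in> space M. \<bar>\<Sum>i=1..n. X' i \<omega>\<bar> \<ge> x}"
    proof
      fix \<omega> assume *: "\<omega> \<in> {\<omega> \<in> space M. \<bar>\<Sum>i=1..n. trunc y (X i \<omega>)\<bar> \<ge> x}"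
      have "X i \<omega> + X' i \<omega> = 2 * trunc y (X i \<omega>)" for i by (simp add: X'_def trunc_def)
      then have "(\<Sum>i=1..n. X i \<omega>) + (\<Sum>i=1..n. X' i \<omega>) = 2 * (\<Sum>i=1..n. trunc y (X i \<omega>))"
        by (simp add: sum_distrib_left flip: sum.distrib)
      then show "\<omega> \<in> {\<omega> \<in> space M. \<bar>\<Sum>i=1..n. X i \<omega>\<bar> \<ge> x} \<union> {\<omega> \<in> space M. \<bar>\<Sum>i=1..n. X' i \<omega>\<bar> \<ge> x}"
        using * by (simp; linarith)
    qed
  qed measurable
  also have "\<dots> \<le> \<P>(\<omega> in M. \<bar>\<Sum>i=1..n. X i \<omega>\<bar> \<ge> x) + \<P>(\<omega> in M. \<bar>\<Sum>i=1..n. X' i \<omega>\<bar> \<ge> x)"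
    by (rule measure_Un_le) measurable
  also have "\<P>(\<omega> in M. \<bar>\<Sum>i=1..n. X' i \<omega>\<bar> \<ge> x) = \<P>(\<omega> in M. \<bar>\<Sum>i=1..n. X i \<omega>\<bar> \<ge> x)"
  proof (rule prob_abs_sum_eq[OF ind' ind])
    fix i assume "i \<in> {1..n}"
    then show "distr M borel (X' i) = distr M borel (X i)"
      using distr_flip_large[of i y] by (simp add: X'_def[abs_def])
  qed
  finally show ?thesis by (simp add: partial_sum_def)
qed

text \<open>Levy's maximal inequality for the increments: on the event that \<open>i\<close> is the first index with a
  large increment, flip the signs of all the other increments.\<close>

lemma prob_max_increment_le:
  "\<P>(\<omega> in M. \<exists>i\<in>{1..n}. \<bar>X i \<omega>\<bar> \<ge> x) \<le> 2 * \<P>(\<omega> in M. \<bar>partial_sum X n \<omega>\<bar> \<ge> x)"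
proof -
  let ?I = "{1..n}"
  have ind: "indep_vars (\<lambda>_. borel) X ?I" by (rule indep_vars_subset[OF indep]) auto
  have rvX [measurable]: "random_variable borel (X i)" if "i \<in> ?I" for i using that rv by auto
  define F where "F i = {\<omega> \<in> space M. \<bar>X i \<omega>\<bar> \<ge> x \<and> (\<forall>j\<in>{1..<i}. \<bar>X j \<omega>\<bar> < x)}" for i
  define B where "B = {\<omega> \<in> space M. \<bar>partial_sum X n \<omega>\<bar> \<ge> x}"
  have F [measurable]: "F i \<in> events" if "i \<in> ?I" for i
  proof -
    have [measurable]: "random_variable borel (X j)" if "j \<in> {1..<i}" for j using that rv by auto
    show ?thesis using \<open>i \<in> ?I\<close> unfolding F_def by measurable
  qed
  have B [measurable]: "B \<in> events" unfolding B_def by measurable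
  have disj: "disjoint_family_on F ?I"
    unfolding disjoint_family_on_def
  proof (intro ballI impI)
    fix i j :: nat assume "i \<in> ?I" "j \<in> ?I" "i \<noteq> j"
    then show "F i \<inter> F j = {}"
      by (cases "i < j") (auto simp: F_def not_less dest!: bspec)
  qed
  have step: "prob (F i) \<le> 2 * prob (F i \<inter> B)" if i: "i \<in> ?I" for i
  proof -
    define X' where "X' j \<omega> = (if j = i then X j \<omega> else - X j \<omega>)" for j \<omega>
    have ind': "indep_vars (\<lambda>_. borel) X' ?I"
      unfolding X'_def by (rule indep_vars_compose2[OF ind, of "\<lambda>j x. if j = i then x else - x"]) measurable
    have [measurable]: "random_variable borel (X' j)" if "j \<in> ?I" for j
      using that ind' by (auto simp: indep_vars_def)
    define B' where "B' = {\<omega> \<in> space M. \<bar>\<Sum>j\<in>?I. X' j \<omega>\<bar> \<ge> x}"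
    have [measurable]: "B' \<in> events" unfolding B'_def by measurable
    define Q where "Q f \<longleftrightarrow> \<bar>f i\<bar> \<ge> x \<and> (\<forall>j\<in>{1..<i}. \<bar>f j\<bar> < x) \<and> \<bar>\<Sum>j\<in>?I. f j\<bar> \<ge> x" for f :: "nat \<Rightarrow> real"
    have 1: "{1..<i} \<subseteq> ?I" using i by auto
    have [measurable]: "(\<lambda>f. f j) \<in> measurable (PiM ?I (\<lambda>_. borel)) borel" if "j \<in> ?I" for j
      using that by (rule measurable_component_singleton)
    have Q: "Measurable.pred (PiM ?I (\<lambda>_. borel)) Q"
    proof -
      have [measurable]: "(\<lambda>f. f j) \<in> measurable (PiM ?I (\<lambda>_. borel)) borel" if "j \<in> {1..<i}" for j
        using that 1 by (intro measurable_component_singleton) auto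
      show ?thesis unfolding Q_def using i by measurable
    qed
    have Fn: "F i \<inter> B = {\<omega> \<in> space M. Q (\<lambda>j\<in>?I. X j \<omega>)}"
      using i by (auto simp: F_def B_def Q_def partial_sum_def)
    \<comment> \<open>\<open>F i\<close> depends on the increments only through their absolute
      values, so it is the same event for \<open>X'\<close>.\<close>
    have Fn': "F i \<inter> B' = {\<omega> \<in> space M. Q (\<lambda>j\<in>?I. X' j \<omega>)}"
      using i by (auto simp: F_def B'_def Q_def X'_def)
    have "prob (F i \<inter> B') = prob (F i \<inter> B)"
      unfolding Fn Fn'
    proof (rule prob_of_independent_eq[OF ind' ind _ _ Q])
      fix j assume "j \<in> ?I"
      then show "distr M borel (X' j) = distr M borel (X j)"
        using sym_i[of j] by (cases "j = i") (simp_all add: X'_def[abs_def])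
    qed (use i in auto)
    moreover have "F i \<subseteq> (F i \<inter> B) \<union> (F i \<inter> B')"
    proof
      fix \<omega> assume \<omega>: "\<omega> \<in> F i"
      \<comment> \<open>The two sums add up to twice the \<open>i\<close>-th increment, so on
        \<open>F i\<close> at least one of them reaches \<open>x\<close> in modulus.\<close>
      have "X j \<omega> + X' j \<omega> = (if j = i then 2 * X i \<omega> else 0)" for j by (simp add: X'_def)
      then have "(\<Sum>j\<in>?I. X j \<omega>) + (\<Sum>j\<in>?I. X' j \<omega>) = 2 * X i \<omega>"
        using i by (simp add: flip: sum.distrib)
      then show "\<omega> \<in> (F i \<inter> B) \<union> (F i \<inter> B')"
        using \<omega> by (simp add: F_def B_def B'_def partial_sum_def) linarith
    qed
    then have "prob (F i) \<le> prob ((F i \<inter> B) \<union> (F i \<inter> B'))"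
      using F[OF i] by (intro finite_measure_mono) auto
    moreover have "\<dots> \<le> prob (F i \<inter> B) + prob (F i \<inter> B')"
      using F[OF i] by (intro measure_Un_le) auto
    ultimately show ?thesis by simp
  qed
  have "\<P>(\<omega> in M. \<exists>i\<in>?I. \<bar>X i \<omega>\<bar> \<ge> x) \<le> prob (\<Union>i\<in>?I. F i)"
  proof (rule finite_measure_mono)
    show "{\<omega> \<in> space M. \<exists>i\<in>?I. \<bar>X i \<omega>\<bar> \<ge> x} \<subseteq> (\<Union>i\<in>?I. F i)"
    proof safe
      fix \<omega> i assume *: "\<omega> \<in> space M" "i \<in> ?I" "\<bar>X i \<omega>\<bar> \<ge> x"
      define k where "k = (LEAST k. k \<in> ?I \<and> \<bar>X k \<omega>\<bar> \<ge> x)"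
      have k: "k \<in> ?I \<and> \<bar>X k \<omega>\<bar> \<ge> x" unfolding k_def by (rule LeastI[of _ i]) (use * in auto)
      moreover have "\<bar>X j \<omega>\<bar> < x" if "j \<in> {1..<k}" for j
        using not_less_Least[of j "\<lambda>k. k \<in> ?I \<and> \<bar>X k \<omega>\<bar> \<ge> x", folded k_def] that k by auto
      ultimately show "\<omega> \<in> (\<Union>i\<in>?I. F i)" using * by (auto simp: F_def)
    qed
  qed (use F in auto)
  also have "\<dots> = (\<Sum>i\<in>?I. prob (F i))"
    using F by (intro finite_measure_finite_Union disj) auto
  also have "\<dots> \<le> (\<Sum>i\<in>?I. 2 * prob (F i \<inter> B))" by (intro sum_mono step)
  also have "\<dots> = 2 * prob (\<Union>i\<in>?I. F i \<inter> B)"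
    using F disj by (subst finite_measure_finite_Union) (auto simp: sum_distrib_left disjoint_family_on_def)
  also have "\<dots> \<le> 2 * prob B" by (intro mult_left_mono finite_measure_mono) auto
  finally show ?thesis by (simp add: B_def)
qed

end

section \<open>Exponential lower bound for symmetric sums\<close>

lemma exp_half_le_one_plus:
  fixes a :: real
  assumes "0 \<le> a" "a \<le> 1"
  shows "exp (a / 2) \<le> 1 + a"
proof -
  have "exp (a/2) \<le> 1 + a/2 + (a/2)\<^sup>2" using assms by (intro exp_le_quadratic) auto
  also have "(a/2)\<^sup>2 \<le> a / 2"
    using assms mult_left_mono[of a 1 a] by (simp add: power2_eq_square)
  finally show ?thesis by simp
qed

context symmetric_iid_sequence
begin

lemma expectation_trunc_eq_0: "expectation (\<lambda>\<omega>. trunc y (X 1 \<omega>)) = 0"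
proof -
  have "expectation (\<lambda>\<omega>. trunc y (- X 1 \<omega>)) = expectation (\<lambda>\<omega>. trunc y (X 1 \<omega>))"
    by (rule expectation_ident[OF _ rv1 sym trunc_measurable]) measurable
  then show ?thesis unfolding trunc_minus by simp
qed

text \<open>The last hypothesis keeps \<open>h\<close> times a truncated value within 1/2 in
  modulus, so quadratic bounds hold both at \<open>h\<close> and at \<open>2 h\<close>, as the first
  and second moments of exp (h S) require.\<close>

lemma partial_sum_lower:
  assumes n: "1 \<le> n" and x: "0 < x" and y: "0 < y"
    and V_def: "V = expectation (\<lambda>\<omega>. (trunc y (X 1 \<omega>))\<^sup>2)" and V: "0 < V"
    and hy: "(16 * x / (real n * V) + 4 / sqrt (real n * V)) * y \<le> 1 / 2"
  shows "exp (- 2048 * x\<^sup>2 / (real n * V)) * exp (- 128) / 8 \<le> \<P>(\<omega> in M. \<bar>partial_sum X n \<omega>\<bar> \<ge> x)"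
proof -
  define N where "N = real n * V"
  have N: "N > 0" using n V by (simp add: N_def)
  \<comment> \<open>The summand \<open>16 x / N\<close> makes the logarithm of the mean, at least
    \<open>h^2 N / 8\<close>, exceed \<open>h x\<close>; the summand \<open>4 / sqrt N\<close> adds
    a surplus of 2. The surplus covers the factor 1/2 in the Paley--Zygmund event and keeps the
    bound meaningful when \<open>x\<close> is small against \<open>sqrt N\<close>.\<close>
  define h where "h = 16 * x / N + 4 / sqrt N"
  have h: "h > 0" using x N by (simp add: h_def add_pos_pos)
  have hy: "h * y \<le> 1 / 2" using hy by (simp add: h_def N_def)
  have ht: "\<bar>h * trunc y u\<bar> \<le> 1 / 2" for u
  proof -
    have "\<bar>h * trunc y u\<bar> \<le> h * y" using h y abs_trunc_le[of y u] by (simp add: abs_mult mult_left_mono)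
    then show ?thesis using hy by simp
  qed
  define \<Phi> where "\<Phi> c = expectation (\<lambda>\<omega>. exp (c * trunc y (X 1 \<omega>)))" for c
  define S where "S \<omega> = (\<Sum>i=1..n. trunc y (X i \<omega>))" for \<omega>
  have ind: "indep_vars (\<lambda>_. borel) X {1..n}" by (rule indep_vars_subset[OF indep]) auto
  have identn: "distr M borel (X i) = distr M borel (X 1)" if "i \<in> {1..n}" for i
    using ident[of i] that by simp
  have bdd: "\<bar>trunc y u\<bar> \<le> y" for u using y abs_trunc_le[of y u] by simp
  have ES: "expectation (\<lambda>\<omega>. exp (c * S \<omega>)) = \<Phi> c ^ n" "integrable M (\<lambda>\<omega>. exp (c * S \<omega>))" for c
    using expectation_exp_sum_iid[OF finite_atLeastAtMost ind rv1 identn trunc_measurable bdd, of c]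
    by (simp_all only: S_def \<Phi>_def card_atLeastAtMost diff_Suc_1)
  have [measurable]: "random_variable borel S"
    unfolding S_def by (rule borel_measurable_sum) (use rv in auto)
  have intE: "integrable M (\<lambda>\<omega>. exp (c * trunc y (X 1 \<omega>)))" for c
  proof (rule bounded_integrable[of _ "exp (\<bar>c\<bar> * y)"])
    fix \<omega>
    have "c * trunc y (X 1 \<omega>) \<le> \<bar>c\<bar> * y"
      using abs_mult[of c "trunc y (X 1 \<omega>)"] mult_left_mono[OF bdd, of "\<bar>c\<bar>" "X 1 \<omega>"] by linarith
    then show "\<bar>exp (c * trunc y (X 1 \<omega>))\<bar> \<le> exp (\<bar>c\<bar> * y)" by simp
  qed measurable
  note int1 = integrable_trunc[OF rv1, of y] and int2 = integrable_trunc_sq[OF rv1, of y]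
  have hV: "h\<^sup>2 * V \<le> 1 / 4"
  proof -
    have "h\<^sup>2 * V = expectation (\<lambda>\<omega>. h\<^sup>2 * (trunc y (X 1 \<omega>))\<^sup>2)" by (simp add: V_def)
    also have "\<dots> \<le> expectation (\<lambda>\<omega>. 1 / 4)"
    proof (rule integral_mono)
      fix \<omega>
      have "\<bar>h * trunc y (X 1 \<omega>)\<bar>\<^sup>2 \<le> (1 / 2)\<^sup>2" by (intro power_mono ht) auto
      then show "h\<^sup>2 * (trunc y (X 1 \<omega>))\<^sup>2 \<le> 1 / 4" by (simp add: power_mult_distrib power_divide)
    qed (use int2 in auto)
    finally show ?thesis by (simp add: prob_space)
  qed
  have low: "1 + h\<^sup>2 * V / 4 \<le> \<Phi> h"
  proof -
    have "1 + h\<^sup>2 * V / 4 = expectation (\<lambda>\<omega>. 1 + h * trunc y (X 1 \<omega>) + h\<^sup>2 / 4 * (trunc y (X 1 \<omega>))\<^sup>2)"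
      using int1 int2 by (simp add: V_def expectation_trunc_eq_0[unfolded One_nat_def] prob_space)
    also have "\<dots> \<le> \<Phi> h"
      unfolding \<Phi>_def
    proof (rule integral_mono)
      fix \<omega>
      show "1 + h * trunc y (X 1 \<omega>) + h\<^sup>2 / 4 * (trunc y (X 1 \<omega>))\<^sup>2 \<le> exp (h * trunc y (X 1 \<omega>))"
        using exp_ge_quarter_quadratic[of "h * trunc y (X 1 \<omega>)"] ht[of "X 1 \<omega>"]
        by (simp add: power_mult_distrib)
    qed (use int1 int2 intE in auto)
    finally show ?thesis .
  qed
  have up: "\<Phi> (2 * h) \<le> exp (4 * h\<^sup>2 * V)"
  proof -
    have "\<Phi> (2 * h) \<le> expectation (\<lambda>\<omega>. 1 + 2 * h * trunc y (X 1 \<omega>) + 4 * h\<^sup>2 * (trunc y (X 1 \<omega>))\<^sup>2)"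
      unfolding \<Phi>_def
    proof (rule integral_mono)
      fix \<omega>
      show "exp (2 * h * trunc y (X 1 \<omega>)) \<le> 1 + 2 * h * trunc y (X 1 \<omega>) + 4 * h\<^sup>2 * (trunc y (X 1 \<omega>))\<^sup>2"
        using exp_le_quadratic[of "2 * h * trunc y (X 1 \<omega>)"] ht[of "X 1 \<omega>"]
        by (simp add: power_mult_distrib abs_mult)
    qed (use int1 int2 intE in auto)
    also have "\<dots> = 1 + 4 * h\<^sup>2 * V"
      using int1 int2 by (simp add: V_def expectation_trunc_eq_0[unfolded One_nat_def] prob_space)
    also have "\<dots> \<le> exp (4 * h\<^sup>2 * V)" by (rule exp_ge_add_one_self)
    finally show ?thesis .
  qed
  define e where "e = expectation (\<lambda>\<omega>. exp (h * S \<omega>))"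
  have e_ge: "exp (h\<^sup>2 * N / 8) \<le> e"
  proof -
    have "exp (h\<^sup>2 * N / 8) = exp (h\<^sup>2 * V / 4 / 2) ^ n"
      by (simp add: N_def mult_ac flip: exp_of_nat_mult)
    also have "\<dots> \<le> (1 + h\<^sup>2 * V / 4) ^ n"
      using hV V by (intro power_mono exp_half_le_one_plus) auto
    also have "\<dots> \<le> \<Phi> h ^ n" using low V by (intro power_mono) auto
    finally show ?thesis by (simp add: e_def ES)
  qed
  have q_le: "expectation (\<lambda>\<omega>. (exp (h * S \<omega>))\<^sup>2) \<le> exp (4 * h\<^sup>2 * N)"
  proof -
    have "expectation (\<lambda>\<omega>. (exp (h * S \<omega>))\<^sup>2) = \<Phi> (2 * h) ^ n"
      unfolding ES(1) [symmetric] by (simp add: exp_double [symmetric] mult.assoc)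
    also have "\<dots> \<le> exp (4 * h\<^sup>2 * V) ^ n"
      using up by (intro power_mono) (auto simp: \<Phi>_def intro!: integral_nonneg_AE)
    also have "\<dots> = exp (4 * h\<^sup>2 * N)" by (simp add: N_def mult_ac flip: exp_of_nat_mult)
    finally show ?thesis .
  qed
  have q_pos: "0 < expectation (\<lambda>\<omega>. (exp (h * S \<omega>))\<^sup>2)"
  proof -
    have "0 < \<Phi> (2 * h) ^ n"
    proof (rule zero_less_power)
      have "0 < exp (- (\<bar>2 * h\<bar> * y))" by simp
      also have "\<dots> = expectation (\<lambda>\<omega>. exp (- (\<bar>2 * h\<bar> * y)))" by (simp add: prob_space)
      also have "\<dots> \<le> \<Phi> (2 * h)"
        unfolding \<Phi>_def
      proof (rule integral_mono)
        fix \<omega>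
        have "\<bar>2 * h * trunc y (X 1 \<omega>)\<bar> \<le> \<bar>2 * h\<bar> * y"
          unfolding abs_mult[of "2 * h"] by (intro mult_left_mono bdd) simp
        then show "exp (- (\<bar>2 * h\<bar> * y)) \<le> exp (2 * h * trunc y (X 1 \<omega>))" by simp
      qed (use intE in auto)
      finally show "0 < \<Phi> (2 * h)" .
    qed
    also have "\<Phi> (2 * h) ^ n = expectation (\<lambda>\<omega>. (exp (h * S \<omega>))\<^sup>2)"
      unfolding ES(1) [symmetric] by (simp add: exp_double [symmetric] mult.assoc)
    finally show ?thesis .
  qed
  have e1: "1 \<le> e" using e_ge N by (meson one_le_exp_iff order_trans divide_nonneg_nonneg mult_nonneg_nonneg
        zero_le_power2 less_imp_le zero_le_numeral)
  \<comment> \<open>From \<open>(a + b)^2 \<le> 2 a^2 + 2 b^2\<close>: the constants are 8 * 256 =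
    2048 and 8 * 16 = 128.\<close>
  have exponent: "4 * h\<^sup>2 * N \<le> 2048 * x\<^sup>2 / N + 128"
  proof -
    have "h\<^sup>2 \<le> 2 * ((16 * x / N)\<^sup>2 + (4 / sqrt N)\<^sup>2)"
      unfolding h_def using sum_squares_bound[of "16 * x / N" "4 / sqrt N"] by (simp add: power2_sum)
    then have "4 * h\<^sup>2 * N \<le> 4 * (2 * ((16 * x / N)\<^sup>2 + (4 / sqrt N)\<^sup>2)) * N"
      using N by (intro mult_right_mono) auto
    also have "\<dots> = 2048 * x\<^sup>2 / N + 128"
      using N by (simp add: power_divide power_mult_distrib field_simps power2_eq_square)
    finally show ?thesis .
  qed
  have "exp (- 2048 * x\<^sup>2 / N) * exp (- 128) / 4 = exp (- (2048 * x\<^sup>2 / N + 128)) / 4"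
    by (simp flip: exp_add)
  also have "\<dots> \<le> exp (- (4 * h\<^sup>2 * N)) / 4" using exponent by simp
  also have "\<dots> = 1 / (4 * exp (4 * h\<^sup>2 * N))" by (simp add: exp_minus field_simps)
  \<comment> \<open>In the numerator only \<open>e \<ge> 1\<close> is used; the loss merely affects
    the constant in the exponent.\<close>
  also have "\<dots> \<le> e\<^sup>2 / (4 * expectation (\<lambda>\<omega>. (exp (h * S \<omega>))\<^sup>2))"
    using e1 q_le q_pos by (intro frac_le) (auto simp: one_le_power)
  also have "\<dots> \<le> \<P>(\<omega> in M. exp (h * S \<omega>) \<ge> e / 2)"
    unfolding e_def
  proof (rule prob_ge_half_mean[OF ES(2)])
    show "integrable M (\<lambda>\<omega>. (exp (h * S \<omega>))\<^sup>2)"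
      using ES(2)[of "2 * h"] by (simp add: exp_double [symmetric] mult.assoc)
    show "0 < expectation (\<lambda>\<omega>. exp (h * S \<omega>))" using e1 by (simp add: e_def)
  qed
  also have "\<dots> \<le> \<P>(\<omega> in M. \<bar>S \<omega>\<bar> \<ge> x)"
  proof (rule finite_measure_mono)
    show "{\<omega> \<in> space M. e / 2 \<le> exp (h * S \<omega>)} \<subseteq> {\<omega> \<in> space M. x \<le> \<bar>S \<omega>\<bar>}"
    proof safe
      fix \<omega> assume *: "e / 2 \<le> exp (h * S \<omega>)"
      \<comment> \<open>Then exp (h S) >= e/2 >= exp (h x + 2) / 2 >= exp (h x), which forces
        \<open>S \<ge> x\<close>.\<close>
      have "h * x + 2 \<le> h\<^sup>2 * N / 8"
      proof -
        have "h * N / 8 = 2 * x + sqrt N / 2"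
          using N by (simp add: h_def field_simps real_div_sqrt flip: real_sqrt_mult)
        then have "h\<^sup>2 * N / 8 = h * (2 * x + sqrt N / 2)" by (simp add: power2_eq_square)
        also have "\<dots> = 2 * (h * x) + h * sqrt N / 2" by (simp add: algebra_simps)
        finally have eq: "h\<^sup>2 * N / 8 = 2 * (h * x) + h * sqrt N / 2" .
        have "4 = 4 / sqrt N * sqrt N" using N by simp
        also have "\<dots> \<le> h * sqrt N" using N x by (intro mult_right_mono) (auto simp: h_def)
        finally have "4 \<le> h * sqrt N" .
        moreover have "0 \<le> h * x" using h x by simp
        ultimately show ?thesis using eq by linarith
      qed
      then have "exp (h * x + 2) \<le> e" using e_ge by (meson exp_le_cancel_iff order_trans)
      then have "exp (h * x) * exp 2 \<le> 2 * exp (h * S \<omega>)" using * by (simp add: exp_add)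
      moreover have "2 \<le> exp (2 :: real)" using exp_ge_add_one_self[of "2 :: real"] by simp
      then have "exp (h * x) * 2 \<le> exp (h * x) * exp 2" by (intro mult_left_mono) auto
      ultimately have "exp (h * x) \<le> exp (h * S \<omega>)" by linarith
      then have "x \<le> S \<omega>" using h by simp
      then show "x \<le> \<bar>S \<omega>\<bar>" by simp
    qed
  qed measurable
  also have "\<dots> \<le> 2 * \<P>(\<omega> in M. \<bar>partial_sum X n \<omega>\<bar> \<ge> x)"
    unfolding S_def by (rule prob_trunc_sum_le)
  finally show ?thesis by (simp add: N_def)
qed

end

section \<open>Symmetrisation by differences of pairs\<close>

context iid_sequence
begin

text \<open>Disjoint pairs keep the differences independent, and everything stays on the given
  probability space: no independent copy of the sequence has to be constructed.\<close>

definition symm :: "nat \<Rightarrow> 'a \<Rightarrow> real" where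
  "symm i \<omega> = X (2 * i) \<omega> - X (2 * i - 1) \<omega>"

text \<open>Applied to different pairs it shows that the differences are identically distributed;
  applied to a pair and its reversal it shows that they are symmetric.\<close>

lemma distr_diff_eq:
  assumes "1 \<le> i" "1 \<le> j" "i \<noteq> j" "1 \<le> k" "1 \<le> l" "k \<noteq> l"
  shows "distr M borel (\<lambda>\<omega>. X i \<omega> - X j \<omega>) = distr M borel (\<lambda>\<omega>. X k \<omega> - X l \<omega>)"
proof -
  let ?I = "{0, 1 :: nat}"
  define \<sigma> where "\<sigma> a = (if a = 0 then i else j)" for a :: nat
  define \<tau> where "\<tau> a = (if a = 0 then k else l)" for a :: nat
  have "indep_vars (\<lambda>_. borel) (\<lambda>a. X (\<sigma> a)) ?I" "indep_vars (\<lambda>_. borel) (\<lambda>a. X (\<tau> a)) ?I"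
    using assms by (auto intro!: indep_vars_inj_reindex[OF indep] simp: \<sigma>_def \<tau>_def)
  moreover have "distr M borel (X (\<sigma> a)) = distr M borel (X (\<tau> a))" for a
    using ident[of "\<sigma> a"] ident[of "\<tau> a"] assms by (simp add: \<sigma>_def \<tau>_def)
  moreover have "(\<lambda>f. f 0 - f 1) \<in> measurable (PiM ?I (\<lambda>_. borel)) (borel :: real measure)"
    by (intro borel_measurable_diff measurable_component_singleton) auto
  ultimately have "distr M borel (\<lambda>\<omega>. (\<lambda>f. f 0 - f 1) (\<lambda>a\<in>?I. X (\<sigma> a) \<omega>)) =
      distr M borel (\<lambda>\<omega>. (\<lambda>f. f 0 - f 1) (\<lambda>a\<in>?I. X (\<tau> a) \<omega>))"
    by (intro distr_of_independent_eq) auto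
  then show ?thesis by (simp add: \<sigma>_def \<tau>_def)
qed

lemma symmetric_symm: "symmetric_iid_sequence M symm"
proof
  have "indep_vars (\<lambda>i. PiM {2 * i - 1, 2 * i} (\<lambda>_. borel))
      (\<lambda>i \<omega>. restrict (\<lambda>j. X j \<omega>) {2 * i - 1, 2 * i}) {1..}"
    by (rule indep_vars_restrict[OF indep]) (auto simp: disjoint_family_on_def)
  then have "indep_vars (\<lambda>_. borel)
      (\<lambda>i \<omega>. (\<lambda>f. f (2 * i) - f (2 * i - 1)) (restrict (\<lambda>j. X j \<omega>) {2 * i - 1, 2 * i})) {1..}"
    by (rule indep_vars_compose2) (intro borel_measurable_diff measurable_component_singleton; simp)
  then show "indep_vars (\<lambda>_. borel) symm {1..}" by (simp add: symm_def[abs_def])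
  show "distr M borel (symm i) = distr M borel (symm 1)" if "1 \<le> i" for i
    unfolding symm_def[abs_def] using that by (intro distr_diff_eq) auto
  have "distr M borel (\<lambda>\<omega>. X 1 \<omega> - X 2 \<omega>) = distr M borel (\<lambda>\<omega>. X 2 \<omega> - X 1 \<omega>)"
    by (rule distr_diff_eq) auto
  then show "distr M borel (\<lambda>\<omega>. - symm 1 \<omega>) = distr M borel (symm 1)"
    by (simp add: symm_def[abs_def])
qed

text \<open>The sum of \<open>n\<close> differences is the difference of the sums over the even and
  the odd indices. Each has \<open>n\<close> terms and the law of the original partial sum, so the
  index \<open>n\<close> is unchanged.\<close>

lemma prob_symm_sum_le:
  "\<P>(\<omega> in M. \<bar>partial_sum symm n \<omega>\<bar> \<ge> 2 * x) \<le> 2 * \<P>(\<omega> in M. \<bar>partial_sum X n \<omega>\<bar> \<ge> x)"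
proof -
  define E where "E \<omega> = (\<Sum>i\<in>{1..n}. X (2 * i) \<omega>)" for \<omega>
  define O' where "O' \<omega> = (\<Sum>i\<in>{1..n}. X (2 * i - 1) \<omega>)" for \<omega>
  have [measurable]: "random_variable borel E" "random_variable borel O'"
    unfolding E_def O'_def by (auto intro!: borel_measurable_sum rv)
  have ind: "indep_vars (\<lambda>_. borel) X {1..n}" by (rule indep_vars_subset[OF indep]) auto
  have same: "\<P>(\<omega> in M. \<bar>\<Sum>i\<in>{1..n}. X (\<sigma> i) \<omega>\<bar> \<ge> x) = \<P>(\<omega> in M. \<bar>partial_sum X n \<omega>\<bar> \<ge> x)"
    if "inj_on \<sigma> {1..n}" "\<And>i. i \<in> {1..n} \<Longrightarrow> 1 \<le> \<sigma> i" for \<sigma>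
    unfolding partial_sum_def
  proof (rule prob_abs_sum_eq[OF _ ind])
    show "indep_vars (\<lambda>_. borel) (\<lambda>i. X (\<sigma> i)) {1..n}"
      using that by (intro indep_vars_inj_reindex[OF indep]) auto
    show "distr M borel (X (\<sigma> i)) = distr M borel (X i)" if i: "i \<in> {1..n}" for i
      using ident[of "\<sigma> i"] ident[of i] that(1) \<open>\<And>i. i \<in> {1..n} \<Longrightarrow> 1 \<le> \<sigma> i\<close>[OF i] by simp
  qed
  have "{\<omega> \<in> space M. \<bar>partial_sum symm n \<omega>\<bar> \<ge> 2 * x} \<subseteq>
      {\<omega> \<in> space M. \<bar>E \<omega>\<bar> \<ge> x} \<union> {\<omega> \<in> space M. \<bar>O' \<omega>\<bar> \<ge> x}"
  proof
    fix \<omega> assume *: "\<omega> \<in> {\<omega> \<in> space M. \<bar>partial_sum symm n \<omega>\<bar> \<ge> 2 * x}"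
    have "partial_sum symm n \<omega> = E \<omega> - O' \<omega>"
      by (simp add: partial_sum_def symm_def E_def O'_def sum_subtractf)
    then show "\<omega> \<in> {\<omega> \<in> space M. \<bar>E \<omega>\<bar> \<ge> x} \<union> {\<omega> \<in> space M. \<bar>O' \<omega>\<bar> \<ge> x}"
      using * by simp linarith
  qed
  then have "\<P>(\<omega> in M. \<bar>partial_sum symm n \<omega>\<bar> \<ge> 2 * x) \<le>
      prob ({\<omega> \<in> space M. \<bar>E \<omega>\<bar> \<ge> x} \<union> {\<omega> \<in> space M. \<bar>O' \<omega>\<bar> \<ge> x})"
    by (rule finite_measure_mono) measurable
  also have "\<dots> \<le> \<P>(\<omega> in M. \<bar>E \<omega>\<bar> \<ge> x) + \<P>(\<omega> in M. \<bar>O' \<omega>\<bar> \<ge> x)"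
    by (rule measure_Un_le) measurable
  also have "\<P>(\<omega> in M. \<bar>E \<omega>\<bar> \<ge> x) = \<P>(\<omega> in M. \<bar>partial_sum X n \<omega>\<bar> \<ge> x)"
    unfolding E_def by (rule same) (auto simp: inj_on_def)
  also have "\<P>(\<omega> in M. \<bar>O' \<omega>\<bar> \<ge> x) = \<P>(\<omega> in M. \<bar>partial_sum X n \<omega>\<bar> \<ge> x)"
    unfolding O'_def by (rule same) (auto simp: inj_on_def)
  finally show ?thesis by simp
qed

end

section \<open>Necessity\<close>

text \<open>As long as \<open>n a_n\<close> is bounded, the summand is comparable to
  \<open>a_n\<close>. Monotonicity excludes large \<open>n a_n\<close>: one large value would make a
  whole dyadic block of the series large.\<close>

lemma summable_of_one_minus_power:
  fixes a :: "nat \<Rightarrow> real"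
  assumes anti: "\<And>m n. m \<le> n \<Longrightarrow> a n \<le> a m" and bounds: "\<And>n. 0 \<le> a n" "\<And>n. a n \<le> 1"
    and sum: "summable (\<lambda>n. (1 - (1 - a n) ^ n) / real n)"
  shows "summable a"
proof -
  define q where "q n = (1 - (1 - a n) ^ n) / real n" for n
  \<comment> \<open>The power is at most exp (- n a_n), hence at most \<open>1 / (1 + z)\<close>.
    Allowing any \<open>z\<close> below \<open>n a_n\<close> serves both the fixed value 1/2 and the
    exact value.\<close>
  have q_ge: "(1 - 1 / (1 + z)) / real n \<le> q n" if "0 \<le> z" "z \<le> real n * a n" for n z
  proof -
    have "(1 - a n) ^ n \<le> exp (- a n) ^ n"
      using bounds(2)[of n] exp_ge_add_one_self[of "- a n"] by (intro power_mono) auto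
    also have "\<dots> = exp (- (real n * a n))" by (simp flip: exp_of_nat_mult)
    also have "\<dots> \<le> exp (- z)" using that by simp
    also have "\<dots> = 1 / exp z" by (simp add: exp_minus field_simps)
    also have "\<dots> \<le> 1 / (1 + z)" using that exp_ge_add_one_self[of z] by (intro divide_left_mono) auto
    finally show ?thesis unfolding q_def by (intro divide_right_mono) auto
  qed
  have q0: "0 \<le> q n" for n using q_ge[of 0 n] bounds by simp
  obtain N where N: "\<And>m n. m \<ge> N \<Longrightarrow> norm (sum q {m..<n}) < 1 / 6"
    using sum unfolding q_def[symmetric] summable_Cauchy by (metis zero_less_divide_1_iff zero_less_numeral)
  \<comment> \<open>If \<open>m a_m > 1\<close>, then \<open>k a_k \<ge> 1/2\<close> for all
    \<open>k\<close> between about \<open>m/2\<close> and \<open>m\<close>. Each such term is at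
    least \<open>1 / (3 m)\<close>, so the block sums to at least 1/6, against the Cauchy
    criterion.\<close>
  have small: "real m * a m \<le> 1" if m: "2 * N + 2 \<le> m" for m
  proof (rule ccontr)
    assume c: "\<not> ?thesis"
    define l where "l = (m + 1) div 2"
    have l: "l \<ge> N" "l \<ge> 1" "2 * l \<le> m + 1" "m \<le> 2 * l" using m unfolding l_def by linarith+
    then have l': "real l \<ge> real m / 2" "real l \<le> real (m + 1) / 2"
      by (simp_all only: le_divide_eq_numeral1 divide_le_eq_numeral1)
    have "1 / 3 / real m \<le> q k" if k: "k \<in> {l..<Suc m}" for k
    proof -
      have "real m / 2 * a m \<le> real k * a k"
        using k l' anti[of k m] bounds(1)[of m] by (intro mult_mono) auto
      then have "(1 - 1 / (1 + 1 / 2)) / real k \<le> q k" using c by (intro q_ge) auto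
      moreover have "1 / 3 / real m \<le> 1 / 3 / real k" using k l by (intro divide_left_mono) auto
      ultimately show ?thesis by simp
    qed
    then have "(\<Sum>k=l..<Suc m. 1 / 3 / real m) \<le> sum q {l..<Suc m}" by (intro sum_mono) auto
    moreover have "(\<Sum>k=l..<Suc m. 1 / 3 / real m) = (real (Suc m) - real l) / (3 * real m)"
      using l(3) l(2) by (simp add: of_nat_diff)
    moreover have "1 / 6 \<le> (real (Suc m) - real l) / (3 * real m)"
      using l' m by (simp add: field_simps)
    ultimately have "1 / 6 \<le> sum q {l..<Suc m}" by linarith
    then show False using N[OF l(1), of "Suc m"] unfolding real_norm_def by linarith
  qed
  show ?thesis
  proof (rule summable_comparison_test_ev)
    show "summable (\<lambda>n. 2 * q n)" using sum unfolding q_def by (rule summable_mult)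
    show "\<forall>\<^sub>F n in sequentially. norm (a n) \<le> 2 * q n"
      using eventually_ge_at_top[of "2 * N + 2"]
    proof eventually_elim
      case (elim n)
      define z where "z = real n * a n"
      have z: "0 \<le> z" "z \<le> 1" using bounds small[OF elim] by (simp_all add: z_def)
      have "a n * (1 + z) \<le> a n * 2" using z bounds by (intro mult_left_mono) auto
      then have "a n \<le> 2 * (a n / (1 + z))" using z by (simp add: field_simps)
      also have "a n / (1 + z) = z / (1 + z) / real n" using elim by (simp add: z_def)
      also have "z / (1 + z) = 1 - 1 / (1 + z)" using z by (simp add: field_simps)
      also have "(1 - 1 / (1 + z)) / real n \<le> q n" using z by (intro q_ge) (auto simp: z_def)
      finally show ?case using bounds by simp
    qed
  qed
qed

lemma summable_blocks:
  fixes g :: "nat \<Rightarrow> real"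
  assumes "\<And>n. 0 \<le> g n" and g: "summable g" and b: "mono b"
  shows "summable (\<lambda>k. \<Sum>n=b k..<b (Suc k). g n)"
proof (rule summableI_nonneg_bounded)
  fix K :: nat
  have "(\<Sum>k<K. \<Sum>n=b k..<b (Suc k). g n) = (\<Sum>n=b 0..<b K. g n)"
  proof (induction K)
    case (Suc K)
    then show ?case
      using b by (simp add: sum.atLeastLessThan_concat monoD)
  qed simp
  also have "\<dots> \<le> suminf g" using assms by (intro sum_le_suminf) auto
  finally show "(\<Sum>k<K. \<Sum>n=b k..<b (Suc k). g n) \<le> suminf g" .
qed (use assms in \<open>auto intro: sum_nonneg\<close>)

context prob_space
begin

lemma tendsto_expectation_trunc:
  assumes "integrable M Y"
  shows "((\<lambda>y. expectation (\<lambda>\<omega>. trunc y (Y \<omega>))) \<longlongrightarrow> expectation Y) at_top"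
proof (rule integral_dominated_convergence_at_top[where w = "\<lambda>\<omega>. \<bar>Y \<omega>\<bar>"])
  have "((\<lambda>y. trunc y x) \<longlongrightarrow> x) at_top" for x
    by (rule tendsto_eventually, rule eventually_mono[OF eventually_gt_at_top[of "\<bar>x\<bar>"]])
       (simp add: trunc_def)
  then show "AE \<omega> in M. ((\<lambda>y. trunc y (Y \<omega>)) \<longlongrightarrow> Y \<omega>) at_top" by simp
qed (use assms in \<open>auto simp: trunc_def\<close>)

lemma tendsto_prob_abs_less:
  fixes Y :: "'a \<Rightarrow> real"
  assumes [measurable]: "random_variable borel Y"
  shows "((\<lambda>y. \<P>(\<omega> in M. \<bar>Y \<omega>\<bar> < y)) \<longlongrightarrow> 1) at_top"
proof -
  have "((\<lambda>y. expectation (\<lambda>\<omega>. if \<bar>Y \<omega>\<bar> < y then 1 else 0 :: real)) \<longlongrightarrow> expectation (\<lambda>\<omega>. 1)) at_top"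
  proof (rule integral_dominated_convergence_at_top[where w = "\<lambda>\<omega>. 1"])
    have "((\<lambda>y. if \<bar>x\<bar> < y then 1 else 0 :: real) \<longlongrightarrow> 1) at_top" for x :: real
      by (rule tendsto_eventually, rule eventually_mono[OF eventually_gt_at_top[of "\<bar>x\<bar>"]]) simp
    then show "AE \<omega> in M. ((\<lambda>y. if \<bar>Y \<omega>\<bar> < y then 1 else 0 :: real) \<longlongrightarrow> 1) at_top" by simp
  qed auto
  moreover have "expectation (\<lambda>\<omega>. if \<bar>Y \<omega>\<bar> < y then 1 else 0 :: real) = \<P>(\<omega> in M. \<bar>Y \<omega>\<bar> < y)" for y
    by (rule expectation_if_eq_prob) measurable
  ultimately show ?thesis by (simp add: prob_space)
qed

text \<open>The integrand is at most twice the number of thresholds not exceeding |Y|, and the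
  expectation of that number is the sum of the probabilities.\<close>

lemma integrable_sq_div_log_plus:
  assumes [measurable]: "random_variable borel Y"
    and sum: "summable (\<lambda>n. \<P>(\<omega> in M. \<bar>Y \<omega>\<bar> \<ge> thr n))"
  shows "integrable M (\<lambda>\<omega>. (Y \<omega>)\<^sup>2 / log_plus \<bar>Y \<omega>\<bar>)"
proof (rule integrableI_bounded)
  show "random_variable borel (\<lambda>\<omega>. (Y \<omega>)\<^sup>2 / log_plus \<bar>Y \<omega>\<bar>)"
    unfolding log_plus_def by measurable
  define E where "E n = {\<omega> \<in> space M. \<bar>Y \<omega>\<bar> \<ge> thr n}" for n
  have [measurable]: "E n \<in> events" for n unfolding E_def by measurable
  \<comment> \<open>The thresholds at 0 and 1 vanish, so these two events are certain. All
    \<open>k + 1\<close> indices up to \<open>k\<close> then count, which matches the bound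
    \<open>2 k + 2\<close>.\<close>
  have thr01: "thr 0 = 0" "thr 1 = 0" by (simp_all add: thr_def)
  have pt: "ennreal (norm ((Y \<omega>)\<^sup>2 / log_plus \<bar>Y \<omega>\<bar>)) \<le> 2 * (\<Sum>n. indicator (E n) \<omega>)" if \<omega>: "\<omega> \<in> space M" for \<omega>
  proof -
    obtain k where k: "(Y \<omega>)\<^sup>2 / log_plus \<bar>Y \<omega>\<bar> \<le> 2 * real k + 2" "\<And>n. n \<in> {2..k} \<Longrightarrow> thr n \<le> \<bar>Y \<omega>\<bar>"
      using sq_div_log_plus_count[of "Y \<omega>"] by blast
    have "\<omega> \<in> E n" if "n \<le> k" for n
      using k(2)[of n] that thr01 \<omega> by (cases "n = 0 \<or> n = 1") (auto simp: E_def)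
    then have "(\<Sum>n\<le>k. indicator (E n) \<omega>) = (\<Sum>n\<le>k. 1 :: ennreal)" by (intro sum.cong) auto
    also have "\<dots> = ennreal (real k + 1)" by (simp add: ennreal_of_nat_eq_real_of_nat add.commute)
    finally have "ennreal (real k + 1) \<le> (\<Sum>n. indicator (E n) \<omega>)"
      using sum_le_suminf[of "\<lambda>n. indicator (E n) \<omega> :: ennreal" "{..k}"] by simp
    then have "2 * ennreal (real k + 1) \<le> 2 * (\<Sum>n. indicator (E n) \<omega>)" by (rule mult_left_mono) simp
    moreover have "2 * ennreal (real k + 1) = ennreal (2 * real k + 2)"
      by (simp add: ennreal_mult' [symmetric] distrib_left flip: ennreal_numeral)
    moreover have "ennreal (norm ((Y \<omega>)\<^sup>2 / log_plus \<bar>Y \<omega>\<bar>)) \<le> ennreal (2 * real k + 2)"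
      using k(1) sq_div_log_plus_nonneg[of "Y \<omega>"] by (intro ennreal_leI) simp
    ultimately show ?thesis by simp
  qed
  have "(\<integral>\<^sup>+\<omega>. ennreal (norm ((Y \<omega>)\<^sup>2 / log_plus \<bar>Y \<omega>\<bar>)) \<partial>M) \<le> (\<integral>\<^sup>+\<omega>. 2 * (\<Sum>n. indicator (E n) \<omega>) \<partial>M)"
    by (intro nn_integral_mono pt)
  also have "\<dots> = 2 * (\<Sum>n. \<integral>\<^sup>+\<omega>. indicator (E n) \<omega> \<partial>M)"
    by (subst nn_integral_cmult) (auto simp: nn_integral_suminf)
  also have "(\<Sum>n. \<integral>\<^sup>+\<omega>. indicator (E n) \<omega> \<partial>M) = (\<Sum>n. ennreal (prob (E n)))"
    by (simp add: emeasure_eq_measure)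
  also have "\<dots> = ennreal (\<Sum>n. prob (E n))"
    using sum by (intro suminf_ennreal2) (auto simp: E_def)
  also have "2 * \<dots> < \<infinity>" by (simp add: ennreal_mult_less_top)
  finally show "(\<integral>\<^sup>+\<omega>. ennreal (norm ((Y \<omega>)\<^sup>2 / log_plus \<bar>Y \<omega>\<bar>)) \<partial>M) < \<infinity>" .
qed

end

section \<open>Largest increment and weak symmetrisation\<close>

context iid_sequence
begin

lemma prob_max_increment_eq:
  "\<P>(\<omega> in M. \<exists>i\<in>{1..n}. \<bar>X i \<omega>\<bar> \<ge> x) = 1 - (1 - \<P>(\<omega> in M. \<bar>X 1 \<omega>\<bar> \<ge> x)) ^ n"
proof (cases "n = 0")
  case False
  have rvX [measurable]: "random_variable borel (X i)" if "i \<in> {1..n}" for i using that rv by auto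
  have ind: "indep_vars (\<lambda>_. borel) X {1..n}" by (rule indep_vars_subset[OF indep]) auto
  let ?A = "{u :: real. \<bar>u\<bar> < x}"
  have one: "prob (X i -` ?A \<inter> space M) = 1 - \<P>(\<omega> in M. \<bar>X 1 \<omega>\<bar> \<ge> x)" if i: "i \<in> {1..n}" for i
  proof -
    have "prob (X i -` ?A \<inter> space M) = \<P>(\<omega> in M. X i \<omega> \<in> ?A)"
      by (intro arg_cong[of _ _ prob]) auto
    also have "\<dots> = \<P>(\<omega> in M. X 1 \<omega> \<in> ?A)"
      using i by (intro prob_ident rvX rv1 ident) auto
    also have "\<dots> = prob (space M - {\<omega> \<in> space M. \<bar>X 1 \<omega>\<bar> \<ge> x})"
      by (intro arg_cong[of _ _ prob]) auto
    also have "\<dots> = 1 - \<P>(\<omega> in M. \<bar>X 1 \<omega>\<bar> \<ge> x)" by (rule prob_compl) measurable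
    finally show ?thesis .
  qed
  have "\<P>(\<omega> in M. \<exists>i\<in>{1..n}. \<bar>X i \<omega>\<bar> \<ge> x) = prob (space M - (\<Inter>i\<in>{1..n}. X i -` ?A \<inter> space M))"
  proof (rule arg_cong[of _ _ prob], rule set_eqI)
    fix \<omega>
    have "(\<exists>i\<in>{1..n}. \<bar>X i \<omega>\<bar> \<ge> x) \<longleftrightarrow> \<not> (\<forall>i\<in>{1..n}. X i \<omega> \<in> ?A)" by (simp add: not_less)
    moreover have "\<omega> \<in> (\<Inter>i\<in>{1..n}. X i -` ?A \<inter> space M) \<longleftrightarrow> \<omega> \<in> space M \<and> (\<forall>i\<in>{1..n}. X i \<omega> \<in> ?A)"
      using False by force
    ultimately show "\<omega> \<in> {\<omega> \<in> space M. \<exists>i\<in>{1..n}. \<bar>X i \<omega>\<bar> \<ge> x} \<longleftrightarrow>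
        \<omega> \<in> space M - (\<Inter>i\<in>{1..n}. X i -` ?A \<inter> space M)"
      by blast
  qed
  also have "\<dots> = 1 - prob (\<Inter>i\<in>{1..n}. X i -` ?A \<inter> space M)"
    using False rvX by (intro prob_compl sets.finite_INT) (auto intro!: measurable_sets)
  also have "prob (\<Inter>i\<in>{1..n}. X i -` ?A \<inter> space M) = (\<Prod>i\<in>{1..n}. prob (X i -` ?A \<inter> space M))"
    using False by (intro indep_varsD_finite[OF ind]) auto
  also have "\<dots> = (\<Prod>i\<in>{1..n}. 1 - \<P>(\<omega> in M. \<bar>X 1 \<omega>\<bar> \<ge> x))" by (intro prod.cong refl one)
  finally show ?thesis by simp
qed simp

lemma expectation_mult_X1_X2:
  fixes g h :: "real \<Rightarrow> real"
  assumes [measurable]: "g \<in> borel_measurable borel" "h \<in> borel_measurable borel"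
    and g: "\<And>x. \<bar>g x\<bar> \<le> B" and h: "\<And>x. \<bar>h x\<bar> \<le> C"
  shows "expectation (\<lambda>\<omega>. g (X 2 \<omega>) * h (X 1 \<omega>)) = expectation (\<lambda>\<omega>. g (X 1 \<omega>)) * expectation (\<lambda>\<omega>. h (X 1 \<omega>))"
    and "integrable M (\<lambda>\<omega>. g (X 2 \<omega>) * h (X 1 \<omega>))"
proof -
  define Y where "Y i \<omega> = (if i = 2 then g (X i \<omega>) else h (X i \<omega>))" for i :: nat and \<omega>
  have rvX: "random_variable borel (X i)" if "i \<in> {1, 2}" for i using that rv[of i] by auto
  have ind: "indep_vars (\<lambda>_. borel) X {1, 2}" by (rule indep_vars_subset[OF indep]) auto
  have ind: "indep_vars (\<lambda>_. borel) Y {1, 2}"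
    unfolding Y_def by (rule indep_vars_compose2[OF ind, of "\<lambda>i x. if i = 2 then g x else h x"]) measurable
  have int: "integrable M (Y i)" if "i \<in> {1, 2}" for i
  proof (rule bounded_integrable[of _ "max B C"])
    show "random_variable borel (Y i)" using ind that by (auto simp: indep_vars_def)
  qed (use g h in \<open>auto simp: Y_def le_max_iff_disj\<close>)
  have eq: "(\<lambda>\<omega>. \<Prod>i\<in>{1, 2}. Y i \<omega>) = (\<lambda>\<omega>. g (X 2 \<omega>) * h (X 1 \<omega>))" by (simp add: Y_def mult.commute)
  show "integrable M (\<lambda>\<omega>. g (X 2 \<omega>) * h (X 1 \<omega>))"
    using indep_vars_integrable[OF _ ind int] unfolding eq by simp
  have "expectation (\<lambda>\<omega>. g (X 2 \<omega>) * h (X 1 \<omega>)) = expectation (\<lambda>\<omega>. g (X 2 \<omega>)) * expectation (\<lambda>\<omega>. h (X 1 \<omega>))"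
    using indep_vars_lebesgue_integral[OF _ ind int] unfolding eq by (simp add: Y_def)
  also have "expectation (\<lambda>\<omega>. g (X 2 \<omega>)) = expectation (\<lambda>\<omega>. g (X 1 \<omega>))"
    by (intro expectation_ident rv1 rvX ident) auto
  finally show "expectation (\<lambda>\<omega>. g (X 2 \<omega>) * h (X 1 \<omega>)) = expectation (\<lambda>\<omega>. g (X 1 \<omega>)) * expectation (\<lambda>\<omega>. h (X 1 \<omega>))" .
qed

lemma prob_symm_ge:
  assumes "0 \<le> s"
  shows "\<P>(\<omega> in M. \<bar>X 1 \<omega>\<bar> \<ge> s) * \<P>(\<omega> in M. \<bar>X 1 \<omega>\<bar> < s / 2) \<le> \<P>(\<omega> in M. \<bar>symm 1 \<omega>\<bar> \<ge> s / 2)"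
proof -
  have rv2 [measurable]: "random_variable borel (X 2)" by (rule rv) simp
  let ?g = "\<lambda>u :: real. if \<bar>u\<bar> \<ge> s then 1 else 0 :: real"
  let ?h = "\<lambda>u :: real. if \<bar>u\<bar> < s / 2 then 1 else 0 :: real"
  have "\<P>(\<omega> in M. \<bar>X 1 \<omega>\<bar> \<ge> s) * \<P>(\<omega> in M. \<bar>X 1 \<omega>\<bar> < s / 2) = expectation (\<lambda>\<omega>. ?g (X 2 \<omega>) * ?h (X 1 \<omega>))"
    by (subst expectation_mult_X1_X2(1)[of _ _ 1 1]) (auto simp: expectation_if_eq_prob)
  also have "\<dots> = expectation (\<lambda>\<omega>. if \<bar>X 2 \<omega>\<bar> \<ge> s \<and> \<bar>X 1 \<omega>\<bar> < s / 2 then 1 else 0)"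
    by (intro Bochner_Integration.integral_cong) auto
  also have "\<dots> = \<P>(\<omega> in M. \<bar>X 2 \<omega>\<bar> \<ge> s \<and> \<bar>X 1 \<omega>\<bar> < s / 2)" by (rule expectation_if_eq_prob) measurable
  also have "\<dots> \<le> \<P>(\<omega> in M. \<bar>symm 1 \<omega>\<bar> \<ge> s / 2)"
  proof (rule finite_measure_mono)
    show "{\<omega> \<in> space M. \<bar>symm 1 \<omega>\<bar> \<ge> s / 2} \<in> events"
      unfolding symm_def by simp
    show "{\<omega> \<in> space M. \<bar>X 2 \<omega>\<bar> \<ge> s \<and> \<bar>X 1 \<omega>\<bar> < s / 2} \<subseteq> {\<omega> \<in> space M. \<bar>symm 1 \<omega>\<bar> \<ge> s / 2}"
    proof safe
      fix \<omega> assume "s \<le> \<bar>X 2 \<omega>\<bar>" "\<bar>X 1 \<omega>\<bar> < s / 2"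
      then have "s / 2 \<le> \<bar>X 2 \<omega> - X 1 \<omega>\<bar>" by linarith
      then show "s / 2 \<le> \<bar>symm 1 \<omega>\<bar>" by (simp add: symm_def)
    qed
  qed
  finally show ?thesis .
qed

end

context prob_space
begin

lemma truncated_second_moment_mono:
  assumes "random_variable borel Y" "y \<le> z"
  shows "expectation (\<lambda>\<omega>. (trunc y (Y \<omega>))\<^sup>2) \<le> expectation (\<lambda>\<omega>. (trunc z (Y \<omega>))\<^sup>2)"
  using assms by (intro integral_mono integrable_trunc_sq) (auto simp: trunc_def)

text \<open>Under (b) the truncated second moment at a level of order \<open>thr n\<close> is at
  most of order \<open>ln n\<close>; this stands in for (c) while the mean is not yet known to
  vanish.\<close>

lemma truncated_second_moment_le:
  assumes Y: "random_variable borel Y"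
    and int: "integrable M (\<lambda>\<omega>. (Y \<omega>)\<^sup>2 / log_plus \<bar>Y \<omega>\<bar>)" and y: "0 < y"
  shows "expectation (\<lambda>\<omega>. (trunc y (Y \<omega>))\<^sup>2) \<le> log_plus y * expectation (\<lambda>\<omega>. (Y \<omega>)\<^sup>2 / log_plus \<bar>Y \<omega>\<bar>)"
proof -
  have "(trunc y x)\<^sup>2 \<le> log_plus y * (x\<^sup>2 / log_plus \<bar>x\<bar>)" for x
  proof (cases "\<bar>x\<bar> < y")
    case True
    have "x\<^sup>2 = log_plus \<bar>x\<bar> * (x\<^sup>2 / log_plus \<bar>x\<bar>)" using log_plus_pos[of "\<bar>x\<bar>"] by simp
    also have "\<dots> \<le> log_plus y * (x\<^sup>2 / log_plus \<bar>x\<bar>)"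
      using True by (intro mult_right_mono sq_div_log_plus_nonneg) (auto simp: log_plus_def)
    finally show ?thesis using True by (simp add: trunc_def)
  next
    case False
    then show ?thesis
      using y log_plus_pos[of y] mult_nonneg_nonneg[OF less_imp_le sq_div_log_plus_nonneg[of x]]
      by (simp add: trunc_def)
  qed
  then have "expectation (\<lambda>\<omega>. (trunc y (Y \<omega>))\<^sup>2) \<le> expectation (\<lambda>\<omega>. log_plus y * ((Y \<omega>)\<^sup>2 / log_plus \<bar>Y \<omega>\<bar>))"
    by (intro integral_mono integrable_trunc_sq Y integrable_mult_right int)
  then show ?thesis by (simp only: integral_mult_right_zero)
qed

end

section \<open>From the convergent series to the moment conditions\<close>

context iid_sequence
begin

interpretation D: symmetric_iid_sequence M symm by (rule symmetric_symm)

lemma summable_symm_sum: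
  assumes "summable (\<lambda>n. \<P>(\<omega> in M. \<bar>partial_sum X n \<omega>\<bar> \<ge> \<epsilon> / 2 * thr n) / real n)"
  shows "summable (\<lambda>n. \<P>(\<omega> in M. \<bar>partial_sum symm n \<omega>\<bar> \<ge> \<epsilon> * thr n) / real n)"
proof (rule summable_comparison_test')
  show "summable (\<lambda>n. 2 * (\<P>(\<omega> in M. \<bar>partial_sum X n \<omega>\<bar> \<ge> \<epsilon> / 2 * thr n) / real n))"
    using assms by (rule summable_mult)
  fix n :: nat
  have "\<P>(\<omega> in M. \<bar>partial_sum symm n \<omega>\<bar> \<ge> \<epsilon> * thr n) / real n
      \<le> 2 * \<P>(\<omega> in M. \<bar>partial_sum X n \<omega>\<bar> \<ge> \<epsilon> / 2 * thr n) / real n"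
    using prob_symm_sum_le[of "\<epsilon> / 2 * thr n" n] by (intro divide_right_mono) auto
  then show "norm (\<P>(\<omega> in M. \<bar>partial_sum symm n \<omega>\<bar> \<ge> \<epsilon> * thr n) / real n)
      \<le> 2 * (\<P>(\<omega> in M. \<bar>partial_sum X n \<omega>\<bar> \<ge> \<epsilon> / 2 * thr n) / real n)" by simp
qed

lemma summable_imp_integrable:
  assumes sum: "\<And>\<epsilon>. 0 < \<epsilon> \<Longrightarrow> summable (\<lambda>n. \<P>(\<omega> in M. \<bar>partial_sum X n \<omega>\<bar> \<ge> \<epsilon> * thr n) / real n)"
  shows "integrable M (\<lambda>\<omega>. (X 1 \<omega>)\<^sup>2 / log_plus \<bar>X 1 \<omega>\<bar>)"
proof (rule integrable_sq_div_log_plus[OF rv1])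
  \<comment> \<open>Half the threshold, because returning from a difference to a single variable
    halves the level.\<close>
  define a where "a n = \<P>(\<omega> in M. \<bar>symm 1 \<omega>\<bar> \<ge> thr n / 2)" for n
  note [measurable] = D.rv1
  have "summable a"
  proof (rule summable_of_one_minus_power)
    show "a n \<le> a m" if "m \<le> n" for m n
      unfolding a_def using thr_mono[OF that] by (intro finite_measure_mono) (auto intro: order_trans)
    show "summable (\<lambda>n. (1 - (1 - a n) ^ n) / real n)"
    proof (rule summable_comparison_test')
      show "summable (\<lambda>n. 2 * (\<P>(\<omega> in M. \<bar>partial_sum symm n \<omega>\<bar> \<ge> 1 / 2 * thr n) / real n))"
        by (intro summable_mult summable_symm_sum sum) simp
      fix n :: nat
      have "1 - (1 - a n) ^ n \<le> 2 * \<P>(\<omega> in M. \<bar>partial_sum symm n \<omega>\<bar> \<ge> thr n / 2)"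
        using D.prob_max_increment_le[where n = n and x = "thr n / 2"]
        unfolding D.prob_max_increment_eq a_def .
      then have "(1 - (1 - a n) ^ n) / real n \<le> 2 * \<P>(\<omega> in M. \<bar>partial_sum symm n \<omega>\<bar> \<ge> thr n / 2) / real n"
        by (intro divide_right_mono) auto
      moreover have "0 \<le> 1 - (1 - a n) ^ n"
        unfolding a_def by (simp add: power_le_one)
      ultimately show "norm ((1 - (1 - a n) ^ n) / real n)
          \<le> 2 * (\<P>(\<omega> in M. \<bar>partial_sum symm n \<omega>\<bar> \<ge> 1 / 2 * thr n) / real n)"
        by simp
    qed
  qed (simp_all add: a_def)
  show "summable (\<lambda>n. \<P>(\<omega> in M. \<bar>X 1 \<omega>\<bar> \<ge> thr n))"
  proof (rule summable_comparison_test_ev)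
    show "summable (\<lambda>n. 2 * a n)" by (rule summable_mult) fact
    \<comment> \<open>Once the other variable of the pair is small with probability above 1/2, a
      large \<open>X 1\<close> is at most twice as likely as a large difference.\<close>
    have "\<forall>\<^sub>F y in at_top. \<P>(\<omega> in M. \<bar>X 1 \<omega>\<bar> < y) > 1 / 2"
      by (rule order_tendstoD[OF tendsto_prob_abs_less[OF rv1]]) simp
    then have "\<forall>\<^sub>F n in sequentially. \<P>(\<omega> in M. \<bar>X 1 \<omega>\<bar> < 1 / 2 * thr n) > 1 / 2"
      by (rule eventually_compose_filterlim[OF _ filterlim_thr]) simp
    then show "\<forall>\<^sub>F n in sequentially. norm (\<P>(\<omega> in M. \<bar>X 1 \<omega>\<bar> \<ge> thr n)) \<le> 2 * a n"
    proof eventually_elim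
      case (elim n)
      have "\<P>(\<omega> in M. \<bar>X 1 \<omega>\<bar> \<ge> thr n) * (1 / 2) \<le> \<P>(\<omega> in M. \<bar>X 1 \<omega>\<bar> \<ge> thr n) * \<P>(\<omega> in M. \<bar>X 1 \<omega>\<bar> < thr n / 2)"
        using elim by (intro mult_left_mono) auto
      also have "\<dots> \<le> a n" unfolding a_def by (rule prob_symm_ge) (rule thr_nonneg)
      finally show ?case by simp
    qed
  qed
qed

text \<open>One large fixed \<open>\<epsilon>\<close> is enough: the sum concentrates within
  \<open>\<epsilon> thr n\<close> of \<open>n m_n\<close>, and a nonzero mean puts this point beyond
  \<open>2 \<epsilon> thr n\<close>. The probabilities in the series then stay bounded below up to a
  summable error, and the harmonic series would converge.\<close>

lemma summable_imp_mean_zero: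
  assumes sum: "\<And>\<epsilon>. 0 < \<epsilon> \<Longrightarrow> summable (\<lambda>n. \<P>(\<omega> in M. \<bar>partial_sum X n \<omega>\<bar> \<ge> \<epsilon> * thr n) / real n)"
    and int: "integrable M (\<lambda>\<omega>. (X 1 \<omega>)\<^sup>2 / log_plus \<bar>X 1 \<omega>\<bar>)"
  shows "expectation (X 1) = 0"
proof (rule ccontr)
  assume nz: "expectation (X 1) \<noteq> 0"
  define \<mu> where "\<mu> = expectation (X 1)"
  define B where "B = expectation (\<lambda>\<omega>. (X 1 \<omega>)\<^sup>2 / log_plus \<bar>X 1 \<omega>\<bar>) + 1"
  have B1: "0 \<le> B - 1"
    unfolding B_def by (simp add: integral_nonneg_AE sq_div_log_plus_nonneg)
  then have B: "B > 0" by linarith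
  \<comment> \<open>Chosen so that \<open>(\<epsilon>/8)^2 = 4 B\<close>. With
    \<open>T n \<le> B ln n\<close> the Gaussian term is at most exp (-4), so twice this term stays
    below 1/2.\<close>
  define \<epsilon> where "\<epsilon> = 16 * sqrt B"
  have \<epsilon>: "\<epsilon> > 0" using B by (simp add: \<epsilon>_def)
  define m where "m n = expectation (\<lambda>\<omega>. trunc (\<epsilon>/8 * thr n) (X 1 \<omega>))" for n
  define T where "T n = trunc_second_moment M (X 1) (\<epsilon>/8) n" for n
  define W where "W n = expectation (\<lambda>\<omega>. jump_weight (\<epsilon>/8 * thr n) (X 1 \<omega>))" for n
  define P where "P n = \<P>(\<omega> in M. \<bar>partial_sum X n \<omega>\<bar> \<ge> \<epsilon> * thr n)" for n
  have "(\<lambda>n. m n) \<longlonglongrightarrow> \<mu>"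
    unfolding m_def \<mu>_def
    by (rule filterlim_compose[OF tendsto_expectation_trunc[OF integrable_of_sq_div_log_plus[OF rv1 int]]
        filterlim_thr]) (use \<epsilon> in simp)
  then have "(\<lambda>n. \<bar>m n\<bar>) \<longlonglongrightarrow> \<bar>\<mu>\<bar>" by (rule tendsto_rabs)
  then have m_ev: "\<forall>\<^sub>F n in sequentially. \<bar>m n\<bar> > \<bar>\<mu>\<bar> / 2"
    using nz by (intro order_tendstoD) (auto simp: \<mu>_def)
  have n_ev: "\<forall>\<^sub>F n in sequentially. 2 * \<epsilon> * thr n < real n * (\<bar>\<mu>\<bar> / 2)"
  proof -
    have "\<bar>\<mu>\<bar> > 0" using nz by (simp add: \<mu>_def)
    then show ?thesis unfolding thr_def using \<epsilon> by real_asymp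
  qed
  have "\<forall>\<^sub>F n in sequentially. log_plus (\<epsilon>/8 * thr n) \<le> ln (real n)"
    using \<epsilon> by (intro eventually_log_plus_thr_le) simp
  then have "\<forall>\<^sub>F n in sequentially. norm (inverse (real n)) \<le> 2 * (P n / real n + 5 * W n)"
    using m_ev n_ev eventually_ge_at_top[of 2]
  proof eventually_elim
    case (elim n)
    have lnn: "ln (real n) > 0" using elim by simp
    have y: "\<epsilon>/8 * thr n > 0" using \<epsilon> thr_pos elim by simp
    have "T n \<le> log_plus (\<epsilon>/8 * thr n) * (B - 1)"
      unfolding T_def trunc_second_moment_eq B_def using truncated_second_moment_le[OF rv1 int y] by simp
    also have "\<dots> \<le> ln (real n) * B"
      using elim lnn B1 by (intro mult_mono) auto
    finally have T_le: "T n \<le> ln (real n) * B" .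
    have G: "real n * tail_term (\<epsilon>/8) (T n) n \<le> 1 / 4"
    proof (cases "T n = 0")
      case False
      then have T: "T n > 0" using trunc_second_moment_nonneg[of "X 1" "\<epsilon>/8" n] by (simp add: T_def)
      have "real n * tail_term (\<epsilon>/8) (T n) n = real n powr (1 + (- 1 - (\<epsilon>/8)\<^sup>2 / T n))"
        using False elim by (subst powr_add) (simp add: tail_term_def)
      also have "\<dots> = exp (- ((\<epsilon>/8)\<^sup>2 / T n * ln (real n)))"
        using elim by (simp add: powr_def)
      also have "\<dots> \<le> exp (- 4)"
      proof -
        have "(\<epsilon>/8)\<^sup>2 = 4 * B" using B by (simp add: \<epsilon>_def power_mult_distrib power_divide)
        then have "4 * T n \<le> (\<epsilon>/8)\<^sup>2 * ln (real n)" using T_le by (simp add: mult.commute)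
        then have "4 \<le> (\<epsilon>/8)\<^sup>2 / T n * ln (real n)" using T by (simp add: field_simps)
        then show ?thesis by simp
      qed
      also have "\<dots> \<le> 1 / 4"
      proof -
        have "4 \<le> exp (4 :: real)" using exp_ge_add_one_self[of "4 :: real"] by simp
        then show ?thesis by (simp add: exp_minus inverse_eq_divide)
      qed
      finally show ?thesis .
    qed (simp add: tail_term_def)
    have "1 = prob (space M)" by (simp add: prob_space)
    also have "\<dots> \<le> prob ({\<omega> \<in> space M. \<bar>partial_sum X n \<omega>\<bar> \<ge> \<epsilon> * thr n} \<union>
        {\<omega> \<in> space M. \<bar>partial_sum X n \<omega> - real n * m n\<bar> \<ge> \<epsilon> * thr n})"
    proof (rule finite_measure_mono)
      have "real n * (\<bar>\<mu>\<bar> / 2) \<le> real n * \<bar>m n\<bar>" using elim by (intro mult_left_mono) auto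
      moreover have "\<bar>real n * m n\<bar> = real n * \<bar>m n\<bar>" by (simp add: abs_mult)
      ultimately have "2 * (\<epsilon> * thr n) < \<bar>real n * m n\<bar>" using elim(3) by linarith
      then have "\<epsilon> * thr n \<le> \<bar>s\<bar> \<or> \<epsilon> * thr n \<le> \<bar>s - real n * m n\<bar>" for s by linarith
      then show "space M \<subseteq> {\<omega> \<in> space M. \<bar>partial_sum X n \<omega>\<bar> \<ge> \<epsilon> * thr n} \<union>
        {\<omega> \<in> space M. \<bar>partial_sum X n \<omega> - real n * m n\<bar> \<ge> \<epsilon> * thr n}" by auto
    qed measurable
    also have "\<dots> \<le> P n + \<P>(\<omega> in M. \<bar>partial_sum X n \<omega> - real n * m n\<bar> \<ge> \<epsilon> * thr n)"
      unfolding P_def by (rule measure_Un_le) measurable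
    also have "\<dots> \<le> P n + (2 * real n * tail_term (\<epsilon>/8) (T n) n + 5 * real n * W n)"
      unfolding m_def T_def W_def using elim \<epsilon> by (intro add_left_mono partial_sum_upper) auto
    finally have "1 / 2 \<le> P n + 5 * real n * W n" using G by simp
    then have "1 / 2 / real n \<le> (P n + 5 * real n * W n) / real n" by (intro divide_right_mono) auto
    also have "\<dots> = P n / real n + 5 * W n" using elim by (simp add: add_divide_distrib)
    finally show ?case by (simp add: inverse_eq_divide)
  qed
  moreover have "summable (\<lambda>n. 2 * (P n / real n + 5 * W n))"
    unfolding P_def W_def using \<epsilon>
    by (intro summable_mult summable_add sum summable_jump_weight[OF rv1 int]) auto
  ultimately have "summable (\<lambda>n. inverse (real n))" by (rule summable_comparison_test_ev)
  then show False using not_summable_harmonic[where 'a = real] by simp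
qed

text \<open>If both variables are below \<open>y/2\<close>, their difference is below
  \<open>y\<close> and its square expands. With \<open>p > 3/4\<close> for the probability of being
  below \<open>y/2\<close> and the squared truncated mean under a quarter of \<open>T\<close>, the
  expectation is at least \<open>2 p T - T/2 \<ge> T\<close>. Positivity at \<open>y0\<close>
  provides the fixed margin under which the squared mean must fall.\<close>

lemma truncated_second_moment_symm_ge:
  assumes int: "integrable M (X 1)" and zero: "expectation (X 1) = 0"
    and T0: "0 < expectation (\<lambda>\<omega>. (trunc y0 (X 1 \<omega>))\<^sup>2)"
  shows "\<forall>\<^sub>F y in at_top. expectation (\<lambda>\<omega>. (trunc (y / 2) (X 1 \<omega>))\<^sup>2) \<le> expectation (\<lambda>\<omega>. (trunc y (symm 1 \<omega>))\<^sup>2)"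
proof -
  define T where "T y = expectation (\<lambda>\<omega>. (trunc y (X 1 \<omega>))\<^sup>2)" for y
  have half: "filterlim (\<lambda>y::real. y / 2) at_top at_top" by real_asymp
  have "\<forall>\<^sub>F y in at_top. \<P>(\<omega> in M. \<bar>X 1 \<omega>\<bar> < y) > 3 / 4"
    by (rule order_tendstoD[OF tendsto_prob_abs_less[OF rv1]]) simp
  then have p_ev: "\<forall>\<^sub>F y in at_top. \<P>(\<omega> in M. \<bar>X 1 \<omega>\<bar> < y / 2) > 3 / 4"
    by (rule eventually_compose_filterlim[OF _ half])
  have "((\<lambda>y. (expectation (\<lambda>\<omega>. trunc y (X 1 \<omega>)))\<^sup>2) \<longlongrightarrow> (expectation (X 1))\<^sup>2) at_top"
    by (intro tendsto_power tendsto_expectation_trunc int)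
  then have "\<forall>\<^sub>F y in at_top. (expectation (\<lambda>\<omega>. trunc y (X 1 \<omega>)))\<^sup>2 < T y0 / 4"
    by (rule order_tendstoD) (use T0 zero in \<open>simp add: T_def\<close>)
  then have m_ev: "\<forall>\<^sub>F y in at_top. (expectation (\<lambda>\<omega>. trunc (y / 2) (X 1 \<omega>)))\<^sup>2 < T y0 / 4"
    by (rule eventually_compose_filterlim[OF _ half])
  have "\<forall>\<^sub>F y in at_top. T (y / 2) \<le> expectation (\<lambda>\<omega>. (trunc y (symm 1 \<omega>))\<^sup>2)"
    using p_ev m_ev eventually_ge_at_top[of "2 * y0"] eventually_gt_at_top[of 0]
  proof eventually_elim
    case (elim y)
    have y: "y > 0" by fact
    let ?t = "trunc (y / 2)"
    let ?c = "\<lambda>u :: real. if \<bar>u\<bar> < y / 2 then 1 else 0 :: real"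
    have [measurable]: "random_variable borel (X 2)" by (rule rv) simp
    have bt: "\<bar>?t u\<bar> \<le> y / 2" for u using y abs_trunc_le[of "y/2" u] by simp
    have bt2: "\<bar>(?t u)\<^sup>2\<bar> \<le> (y / 2)\<^sup>2" for u
      using power_mono[OF bt[of u], of 2] by simp
    have bc: "\<bar>?c u\<bar> \<le> 1" for u by simp
    note e1 = expectation_mult_X1_X2[OF _ _ bt2 bc] and e2 = expectation_mult_X1_X2[OF _ _ bc bt2]
      and e3 = expectation_mult_X1_X2[OF _ _ bt bt]
    have Ec: "expectation (\<lambda>\<omega>. ?c (X 1 \<omega>)) = \<P>(\<omega> in M. \<bar>X 1 \<omega>\<bar> < y / 2)"
      by (rule expectation_if_eq_prob) measurable
    have Ty: "T y0 \<le> T (y / 2)"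
      unfolding T_def using elim by (intro truncated_second_moment_mono rv1) simp
    have "T (y / 2) * (3 / 4) \<le> T (y / 2) * \<P>(\<omega> in M. \<bar>X 1 \<omega>\<bar> < y / 2)"
      using elim by (intro mult_left_mono) (auto simp: T_def intro!: integral_nonneg_AE)
    then have "T (y / 2) \<le> T (y / 2) * \<P>(\<omega> in M. \<bar>X 1 \<omega>\<bar> < y / 2) + \<P>(\<omega> in M. \<bar>X 1 \<omega>\<bar> < y / 2) * T (y / 2)
        - 2 * (expectation (\<lambda>\<omega>. ?t (X 1 \<omega>)) * expectation (\<lambda>\<omega>. ?t (X 1 \<omega>)))"
      using elim Ty by (simp add: power2_eq_square)
    also have "\<dots> = expectation (\<lambda>\<omega>. (?t (X 2 \<omega>))\<^sup>2 * ?c (X 1 \<omega>) + ?c (X 2 \<omega>) * (?t (X 1 \<omega>))\<^sup>2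
        - 2 * (?t (X 2 \<omega>) * ?t (X 1 \<omega>)))"
    proof -
      have "integrable M (\<lambda>\<omega>. (?t (X 2 \<omega>))\<^sup>2 * ?c (X 1 \<omega>))" "integrable M (\<lambda>\<omega>. ?c (X 2 \<omega>) * (?t (X 1 \<omega>))\<^sup>2)"
        "integrable M (\<lambda>\<omega>. ?t (X 2 \<omega>) * ?t (X 1 \<omega>))"
        by (rule e1(2) e2(2) e3(2); measurable)+
      moreover have "expectation (\<lambda>\<omega>. (?t (X 2 \<omega>))\<^sup>2 * ?c (X 1 \<omega>)) = T (y / 2) * \<P>(\<omega> in M. \<bar>X 1 \<omega>\<bar> < y / 2)"
        unfolding T_def Ec [symmetric] by (rule e1(1)) measurable
      moreover have "expectation (\<lambda>\<omega>. ?c (X 2 \<omega>) * (?t (X 1 \<omega>))\<^sup>2) = \<P>(\<omega> in M. \<bar>X 1 \<omega>\<bar> < y / 2) * T (y / 2)"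
        unfolding T_def Ec [symmetric] by (rule e2(1)) measurable
      moreover have "expectation (\<lambda>\<omega>. ?t (X 2 \<omega>) * ?t (X 1 \<omega>)) =
          expectation (\<lambda>\<omega>. ?t (X 1 \<omega>)) * expectation (\<lambda>\<omega>. ?t (X 1 \<omega>))"
        by (rule e3(1)) measurable
      ultimately show ?thesis
        by (subst Bochner_Integration.integral_diff Bochner_Integration.integral_add;
            (intro Bochner_Integration.integrable_add integrable_mult_right)?; simp)+
    qed
    also have "\<dots> \<le> expectation (\<lambda>\<omega>. (trunc y (symm 1 \<omega>))\<^sup>2)"
    proof (rule integral_mono)
      have "integrable M (\<lambda>\<omega>. (?t (X 2 \<omega>))\<^sup>2 * ?c (X 1 \<omega>))" "integrable M (\<lambda>\<omega>. ?c (X 2 \<omega>) * (?t (X 1 \<omega>))\<^sup>2)"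
        "integrable M (\<lambda>\<omega>. ?t (X 2 \<omega>) * ?t (X 1 \<omega>))"
        by (rule e1(2) e2(2) e3(2); measurable)+
      then show "integrable M (\<lambda>\<omega>. (?t (X 2 \<omega>))\<^sup>2 * ?c (X 1 \<omega>) + ?c (X 2 \<omega>) * (?t (X 1 \<omega>))\<^sup>2
        - 2 * (?t (X 2 \<omega>) * ?t (X 1 \<omega>)))"
        by (intro Bochner_Integration.integrable_add Bochner_Integration.integrable_diff integrable_mult_right)
      show "integrable M (\<lambda>\<omega>. (trunc y (symm 1 \<omega>))\<^sup>2)" by (rule integrable_trunc_sq[OF D.rv1])
      fix \<omega>
      have "(?t u)\<^sup>2 * ?c v + ?c u * (?t v)\<^sup>2 - 2 * (?t u * ?t v) \<le> (trunc y (u - v))\<^sup>2" for u v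
      proof (cases "\<bar>u\<bar> < y / 2 \<and> \<bar>v\<bar> < y / 2")
        case True
        then have "\<bar>u - v\<bar> < y" by linarith
        then show ?thesis using True by (simp add: trunc_def power2_diff)
      next
        case False
        then show ?thesis by (auto simp: trunc_def)
      qed
      then show "(?t (X 2 \<omega>))\<^sup>2 * ?c (X 1 \<omega>) + ?c (X 2 \<omega>) * (?t (X 1 \<omega>))\<^sup>2
        - 2 * (?t (X 2 \<omega>) * ?t (X 1 \<omega>)) \<le> (trunc y (symm 1 \<omega>))\<^sup>2" by (simp add: symm_def)
    qed
    finally show ?case .
  qed
  then show ?thesis by (simp add: T_def)
qed

text \<open>The \<open>k\<close>-th term of (c) is compared with the block of \<open>n\<close> from
  \<open>k^3\<close> to \<open>(k+1)^3\<close>. The sum of \<open>1/n\<close> over that block is of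
  order \<open>1/k\<close>, which is the factor preceding the exponential in (c).\<close>

lemma summable_imp_tails:
  assumes sum: "\<And>\<epsilon>. 0 < \<epsilon> \<Longrightarrow> summable (\<lambda>n. \<P>(\<omega> in M. \<bar>partial_sum X n \<omega>\<bar> \<ge> \<epsilon> * thr n) / real n)"
    and int: "integrable M (X 1)" and zero: "expectation (X 1) = 0" and \<epsilon>: "0 < \<epsilon>"
  shows "summable (\<lambda>n. tail_term \<epsilon> (trunc_second_moment M (X 1) \<epsilon> n) n)"
proof -
  define T where "T y = expectation (\<lambda>\<omega>. (trunc y (X 1 \<omega>))\<^sup>2)" for y
  have T_eq: "trunc_second_moment M (X 1) \<epsilon> n = T (\<epsilon> * thr n)" for n
    unfolding T_def by (rule trunc_second_moment_eq)
  have T_nonneg: "0 \<le> T y" for y unfolding T_def by (intro integral_nonneg_AE) simp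
  have T_mono: "T y \<le> T z" if "y \<le> z" for y z
    unfolding T_def using that by (intro truncated_second_moment_mono rv1)
  show ?thesis
  proof (cases "\<forall>y. T y = 0")
    \<comment> \<open>Here the convention for \<open>tail_term\<close> at \<open>T = 0\<close> makes
      every summand vanish.\<close>
    case True
    then show ?thesis unfolding T_eq by (simp add: tail_term_def)
  next
    case False
    then obtain y0 where "T y0 \<noteq> 0" by blast
    then have T0: "T y0 > 0" using T_nonneg[of y0] by linarith
    define V where "V y = expectation (\<lambda>\<omega>. (trunc y (symm 1 \<omega>))\<^sup>2)" for y
    \<comment> \<open>Small enough that \<open>2048 * 6 * e^2 \<le> \<epsilon>^2\<close>: 2048 is
      the constant of the lower bound and 6 the loss in \<open>ln n \<le> 6 ln k\<close>.\<close>
    define e where "e = \<epsilon> / 200"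
    have e: "e > 0" using \<epsilon> by (simp add: e_def)
    define P where "P n = \<P>(\<omega> in M. \<bar>partial_sum symm n \<omega>\<bar> \<ge> e * thr n)" for n
    have sumP: "summable (\<lambda>n. P n / real n)"
      unfolding P_def using e by (intro summable_symm_sum sum) simp
    define c0 :: real where "c0 = exp (- 128) / 8"
    have c0: "c0 > 0" by (simp add: c0_def)
    \<comment> \<open>The exponent 1/4 is below 1/2, so this level times an \<open>h\<close> of
      order \<open>sqrt (ln n / n)\<close> tends to 0. Along cubes it becomes 3/4, above 1/2, so
      that it overtakes \<open>\<epsilon> thr k\<close>.\<close>
    have q: "filterlim (\<lambda>n. real n powr (1/4)) at_top sequentially" by real_asymp
    have "\<forall>\<^sub>F y in at_top. T (y / 2) \<le> V y"
      using truncated_second_moment_symm_ge[OF int zero] T0 unfolding T_def V_def by blast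
    then have "\<forall>\<^sub>F n in sequentially. T (real n powr (1/4) / 2) \<le> V (real n powr (1/4))"
      by (rule eventually_compose_filterlim[OF _ q])
    moreover have "\<forall>\<^sub>F n in sequentially. y0 \<le> real n powr (1/4) / 2" by real_asymp
    moreover have "\<forall>\<^sub>F n in sequentially.
        (16 * (e * thr n) / (real n * T y0) + 4 / sqrt (real n * T y0)) * real n powr (1/4) \<le> 1 / 2"
      unfolding thr_def using T0 e by real_asymp
    ultimately have "\<forall>\<^sub>F n in sequentially. c0 * exp (- (2048 * e\<^sup>2 * ln (real n) / T (real n powr (1/4) / 2))) \<le> P n"
      using eventually_ge_at_top[of 2]
    proof eventually_elim
      case (elim n)
      define y where "y = real n powr (1/4)"
      define t where "t = T (y / 2)"
      have y: "y > 0" using elim by (simp add: y_def)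
      have t: "T y0 \<le> t" using elim T_mono by (simp add: t_def y_def)
      have tV: "t \<le> V y" using elim by (simp add: t_def y_def)
      have x: "e * thr n > 0" using e thr_pos elim by simp
      have pos: "0 < real n * T y0" "0 < t" "0 < V y" using elim T0 t tV by auto
      have le: "real n * T y0 \<le> real n * V y" using t tV by (intro mult_left_mono) auto
      have "(16 * (e * thr n) / (real n * V y) + 4 / sqrt (real n * V y)) * y
          \<le> (16 * (e * thr n) / (real n * T y0) + 4 / sqrt (real n * T y0)) * y"
        using le pos x y by (intro mult_right_mono add_mono divide_left_mono) auto
      also have "\<dots> \<le> 1 / 2" using elim by (simp add: y_def)
      finally have "exp (- 2048 * (e * thr n)\<^sup>2 / (real n * V y)) * exp (- 128) / 8 \<le> P n"
        unfolding P_def using x y pos elim by (intro D.partial_sum_lower[where y = y]) (auto simp: V_def)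
      moreover have "- 2048 * (e * thr n)\<^sup>2 / (real n * V y) = - (2048 * e\<^sup>2 * ln (real n) / V y)"
        using elim by (simp add: power_mult_distrib thr_sq)
      moreover have "2048 * e\<^sup>2 * ln (real n) / V y \<le> 2048 * e\<^sup>2 * ln (real n) / t"
        using pos tV elim by (intro divide_left_mono) auto
      ultimately have P: "c0 * exp (- (2048 * e\<^sup>2 * ln (real n) / V y)) \<le> P n"
        and "exp (- (2048 * e\<^sup>2 * ln (real n) / t)) \<le> exp (- (2048 * e\<^sup>2 * ln (real n) / V y))"
        by (simp_all add: c0_def mult.commute)
      then have "c0 * exp (- (2048 * e\<^sup>2 * ln (real n) / t)) \<le> c0 * exp (- (2048 * e\<^sup>2 * ln (real n) / V y))"
        using c0 by (intro mult_left_mono) auto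
      then have "c0 * exp (- (2048 * e\<^sup>2 * ln (real n) / t)) \<le> P n" using P by (rule order_trans)
      then show ?case unfolding t_def y_def .
    qed
    then obtain N where N: "\<And>n. n \<ge> N \<Longrightarrow>
        c0 * exp (- (2048 * e\<^sup>2 * ln (real n) / T (real n powr (1/4) / 2))) \<le> P n"
      by (auto simp: eventually_sequentially)
    define B where "B k = (\<Sum>n=k^3..<(Suc k)^3. P n / real n)" for k :: nat
    have "summable B"
      unfolding B_def by (rule summable_blocks[where b = "\<lambda>k. k ^ 3"])
        (use sumP in \<open>auto simp: P_def mono_def intro: power_mono\<close>)
    have "\<forall>\<^sub>F k in sequentially. \<epsilon> * thr k \<le> real k powr (3/4) / 2"
      unfolding thr_def using \<epsilon> by real_asymp
    moreover have "\<forall>\<^sub>F k in sequentially. y0 \<le> \<epsilon> * thr k"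
      using filterlim_thr[OF \<epsilon>] by (simp add: filterlim_at_top)
    ultimately have "\<forall>\<^sub>F k in sequentially. norm (tail_term \<epsilon> (T (\<epsilon> * thr k)) k) \<le> 8 / (3 * c0) * B k"
      using eventually_ge_at_top[of "max N 2"]
    proof eventually_elim
      case (elim k)
      define t where "t = T (\<epsilon> * thr k)"
      define \<tau> where "\<tau> = tail_term \<epsilon> t k"
      have k: "k \<ge> 2" "k \<ge> N" using elim by auto
      have t: "t > 0" using T0 T_mono[of y0 "\<epsilon> * thr k"] elim by (simp add: t_def)
      have \<tau>: "real k * \<tau> = exp (- (\<epsilon>\<^sup>2 / t * ln (real k)))"
      proof -
        have "real k * \<tau> = real k powr (1 + (- 1 - \<epsilon>\<^sup>2 / t))"
          using t k by (subst powr_add) (simp add: \<tau>_def tail_term_def)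
        then show ?thesis using k by (simp add: powr_def)
      qed
      have \<tau>0: "\<tau> \<ge> 0" by (simp add: \<tau>_def tail_term_def)
      have each: "c0 * (real k * \<tau>) / real ((Suc k)^3) \<le> P n / real n" if n: "n \<in> {k^3..<(Suc k)^3}" for n
      proof -
        have "k \<le> k ^ 3" using k by (intro self_le_power) auto
        then have n1: "n \<ge> N" "n \<ge> 2" using n k by auto
        have "real (k ^ 3) \<le> real n" using n by (simp only: of_nat_le_iff atLeastLessThan_iff)
        then have kn: "real k ^ 3 \<le> real n" by (simp only: of_nat_power)
        have "real k powr (3/4) = (real k powr 3) powr (1/4)" unfolding powr_powr by simp
        also have "real k powr 3 = real k ^ 3" using k by (intro powr_numeral) simp
        also have "(real k ^ 3) powr (1/4) \<le> real n powr (1/4)" using kn by (intro powr_mono2) auto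
        finally have "\<epsilon> * thr k \<le> real n powr (1/4) / 2" using elim by linarith
        then have tn: "t \<le> T (real n powr (1/4) / 2)" unfolding t_def by (rule T_mono)
        \<comment> \<open>The crude bound \<open>(k+1)^3 \<le> k^6\<close> suffices, since only
          \<open>ln n\<close> is to be compared with \<open>ln k\<close>.\<close>
        have "2 * k \<le> k * k" using k by (intro mult_le_mono1)
        then have "Suc k \<le> k ^ 2" using k unfolding power2_eq_square by linarith
        then have "(Suc k) ^ 3 \<le> (k ^ 2) ^ 3" by (rule power_mono) simp
        also have "(k ^ 2) ^ 3 = k ^ 6" by (simp flip: power_mult)
        finally have "n \<le> k ^ 6" using n unfolding atLeastLessThan_iff by linarith
        then have "real n \<le> real (k ^ 6)" by (simp only: of_nat_le_iff)
        then have "real n \<le> real k ^ 6" by (simp only: of_nat_power)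
        then have "ln (real n) \<le> ln (real k ^ 6)" using n1 k by simp
        then have lnn: "ln (real n) \<le> 6 * ln (real k)" using k by (simp add: ln_realpow)
        have "2048 * e\<^sup>2 * ln (real n) / T (real n powr (1/4) / 2) \<le> 2048 * e\<^sup>2 * (6 * ln (real k)) / t"
          using lnn tn t n1 k by (intro frac_le mult_left_mono) auto
        also have "\<dots> = 12288 / 40000 * (\<epsilon>\<^sup>2 / t * ln (real k))"
          by (simp add: e_def power_divide)
        also have "\<dots> \<le> 1 * (\<epsilon>\<^sup>2 / t * ln (real k))"
          using t k by (intro mult_right_mono) auto
        finally have "real k * \<tau> \<le> exp (- (2048 * e\<^sup>2 * ln (real n) / T (real n powr (1/4) / 2)))"
          unfolding \<tau> by simp
        then have "c0 * (real k * \<tau>) \<le> P n"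
          using c0 by (intro order_trans[OF mult_left_mono N[OF n1(1)]]) auto
        moreover have "0 \<le> P n" by (simp add: P_def)
        moreover have "real n \<le> real ((Suc k)^3)" using n by (simp only: of_nat_le_iff atLeastLessThan_iff less_imp_le)
        ultimately show ?thesis using n1 by (intro frac_le) simp_all
      qed
      have "(\<Sum>n=k^3..<(Suc k)^3. c0 * (real k * \<tau>) / real ((Suc k)^3)) \<le> B k"
        unfolding B_def by (intro sum_mono each)
      moreover have "3 / 8 * (c0 * \<tau>) \<le> (\<Sum>n=k^3..<(Suc k)^3. c0 * (real k * \<tau>) / real ((Suc k)^3))"
      proof -
        \<comment> \<open>The block has at least \<open>3 k^2\<close> members, and its denominators
          are at most \<open>(2 k)^3\<close>; this yields the factor 3/8.\<close>
        have card: "real ((Suc k)^3 - k^3) = 3 * real k ^ 2 + 3 * real k + 1"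
        proof -
          have "(Suc k)^3 - k^3 = 3 * k ^ 2 + 3 * k + 1"
            by (simp add: power2_eq_square power3_eq_cube algebra_simps)
          then show ?thesis by simp
        qed
        have "real ((Suc k)^3) \<le> (2 * real k) ^ 3"
        proof -
          have "real (Suc k) ^ 3 \<le> (2 * real k) ^ 3" using k by (intro power_mono) auto
          then show ?thesis by simp
        qed
        then have "real ((Suc k)^3) \<le> 8 * real k ^ 3" by (simp add: power_mult_distrib)
        moreover have "0 < real ((Suc k)^3)" by simp
        ultimately have "3 / 8 \<le> 3 * real k ^ 3 / real ((Suc k)^3)"
          by (simp add: pos_le_divide_eq del: of_nat_power of_nat_Suc)
        then have "3 / 8 * (c0 * \<tau>) \<le> 3 * real k ^ 3 / real ((Suc k)^3) * (c0 * \<tau>)"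
          using c0 \<tau>0 by (intro mult_right_mono) auto
        also have "\<dots> = 3 * real k ^ 2 * (c0 * (real k * \<tau>) / real ((Suc k)^3))"
          by (simp add: power2_eq_square power3_eq_cube)
        also have "\<dots> \<le> real ((Suc k)^3 - k^3) * (c0 * (real k * \<tau>) / real ((Suc k)^3))"
          unfolding card using c0 \<tau>0 by (intro mult_right_mono) auto
        finally show ?thesis by simp
      qed
      ultimately have "3 / 8 * (c0 * \<tau>) \<le> B k" by linarith
      then have "\<tau> \<le> 8 / (3 * c0) * B k" using c0 by (simp add: field_simps)
      then show ?case using \<tau>0 by (simp add: \<tau>_def t_def)
    qed
    moreover have "summable (\<lambda>k. 8 / (3 * c0) * B k)" by (rule summable_mult) fact
    ultimately show ?thesis unfolding T_eq by (rule summable_comparison_test_ev)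
  qed
qed

end

text \<open>Condition (a) states integrability explicitly, because the Bochner integral of a
  nonintegrable function is 0 by convention.\<close>

theorem corollary4:
  fixes M :: "'a measure" and X :: "nat \<Rightarrow> 'a \<Rightarrow> real"
  assumes "prob_space M"
    and indep: "prob_space.indep_vars M (\<lambda>_. borel) X {1..}"
    and ident: "\<And>i. i \<ge> 1 \<Longrightarrow> distr M borel (X i) = distr M borel (X 1)"
  shows "(\<forall>\<epsilon>>0. (\<lambda>n. \<P>(\<omega> in M. \<bar>partial_sum X n \<omega>\<bar> \<ge> \<epsilon> * sqrt (real n * ln (real n))) / real n)
                    summable_on {2..})
     \<longleftrightarrow>
         (integrable M (X 1) \<and> (LINT \<omega>|M. X 1 \<omega>) = 0)
       \<and> integrable M (\<lambda>\<omega>. (X 1 \<omega>)\<^sup>2 / log_plus \<bar>X 1 \<omega>\<bar>)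
       \<and> (\<forall>\<epsilon>>0. (\<lambda>n. tail_term \<epsilon> (trunc_second_moment M (X 1) \<epsilon> n) n) summable_on {2..})"
  (is "?S \<longleftrightarrow> ?R")
proof -
  interpret iid_sequence M X
    by (rule iid_sequence.intro[OF assms(1) iid_sequence_axioms.intro]) fact+
  have S: "?S \<longleftrightarrow> (\<forall>\<epsilon>>0. summable (\<lambda>n. \<P>(\<omega> in M. \<bar>partial_sum X n \<omega>\<bar> \<ge> \<epsilon> * thr n) / real n))"
    unfolding thr_def by (subst summable_on_from_2_iff) simp_all
  have R: "(\<forall>\<epsilon>>0. (\<lambda>n. tail_term \<epsilon> (trunc_second_moment M (X 1) \<epsilon> n) n) summable_on {2..}) \<longleftrightarrow>
      (\<forall>\<epsilon>>0. summable (\<lambda>n. tail_term \<epsilon> (trunc_second_moment M (X 1) \<epsilon> n) n))"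
    by (subst summable_on_from_2_iff) (simp_all add: tail_term_def)
  show ?thesis
  proof
    assume ?S
    then have sum: "summable (\<lambda>n. \<P>(\<omega> in M. \<bar>partial_sum X n \<omega>\<bar> \<ge> \<epsilon> * thr n) / real n)" if "0 < \<epsilon>" for \<epsilon>
      using that unfolding S by blast
    \<comment> \<open>The order matters: (b) gives integrability and enters the proof that the mean
      vanishes, and both of these are needed for (c).\<close>
    have int2: "integrable M (\<lambda>\<omega>. (X 1 \<omega>)\<^sup>2 / log_plus \<bar>X 1 \<omega>\<bar>)" by (rule summable_imp_integrable[OF sum])
    moreover have int: "integrable M (X 1)" by (rule integrable_of_sq_div_log_plus[OF rv1 int2])
    moreover have zero: "expectation (X 1) = 0" by (rule summable_imp_mean_zero[OF sum int2])
    moreover have "summable (\<lambda>n. tail_term \<epsilon> (trunc_second_moment M (X 1) \<epsilon> n) n)" if "0 < \<epsilon>" for \<epsilon>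
      by (rule summable_imp_tails[OF sum int zero that])
    ultimately show ?R unfolding R by blast
  next
    assume ?R
    then show ?S unfolding S R using summable_of_moments by blast
  qed
qed

end
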